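(* In the setting and notation of the context, suppose Assumptions A and D (stated in the context) are satisfied, that $r_n(\widehat\theta_n(\mathsf{x})-\theta_0(\mathsf{x}))=O_{\mathbb{P}}(1)$, and that the tuning parameter $\epsilon_n>0$ satisfies $\epsilon_n\to0$. If $\bar q$ and $\underline{s}$ are integers with $q\le\bar q\le\underline{s}<s$, where $s$ is the smoothness index in Assumption A, then $$a_n^{q-j}\left(\widetilde{\mathcal{D}}^{\mathtt{BR}}_{j,n}(\mathsf{x})-\mathcal{D}_j(\mathsf{x})\right)=O\left(a_n^{q-j}\epsilon_n^{\min(\underline{s}+1,s)-j}\right)+O_{\mathbb{P}}\left[(a_n\epsilon_n)^{-(j+1/2)}+(a_n\epsilon_n)^{-j}\right],\qquad j=1,\dots,\underline{s}.$$ In particular, if also $$n\,\epsilon_n^{(1+2\bar q)\min(\underline{s},s-1)/(\bar q-1)}\to0\quad\text{and}\quad n\,\epsilon_n^{1+2\bar q}\to\infty$$ (the first condition being void when $\bar q=1$), then $$a_n^{q-(2\ell-1)}\left(\widetilde{\mathcal{D}}^{\mathtt{BR}}_{2\ell-1,n}(\mathsf{x})-\mathcal{D}_{2\ell-1}(\mathsf{x})\right)=o_{\mathbb{P}}(1),\qquad \ell=1,\dots,\lfloor(\bar q+1)/2\rfloor,$$ and the function $$\widetilde M_{\mathsf{x},n}(v)=\sum_{\ell=1}^{\lfloor(\bar q+1)/2\rfloor}\widetilde{\mathcal{D}}^{\mathtt{BR}}_{2\ell-1,n}(\mathsf{x})^+\,v^{2\ell}$$ satisfies: $\widetilde M^q_{\mathsf{x},n}\rightsquigarrow_{\mathbb{P}}\mathcal{M}^q_{\mathsf{x}}$,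 where $\widetilde M^q_{\mathsf{x},n}(v)=\sqrt{na_n}\,\widetilde M_{\mathsf{x},n}(va_n^{-1})$, and, for some $c>0$ and every $K>0$, $\liminf_{n\to\infty}\mathbb{P}[\inf_{|v|>K^{-1}}\widetilde M_{\mathsf{x},n}(v)\ge cK^{-(q+1)}]=1$.
   Context: **Conventions.** Limits are as $n\to\infty$. $\mathsf{GCM}_J(f)$ is the greatest convex minorant of $f$ on $J$; $\partial_-$ is the left derivative; $\partial^j$ is the $j$th derivative. For $f:I\to\mathbb{R}$ non-decreasing and right-continuous, $f^-(y)=\inf\{u\in I: f(u)\ge y\}$ (with $\inf\emptyset=\sup I$). $\lfloor a\rfloor$ is the integer part and $a^+=\max(a,0)$. $\rightsquigarrow_{\mathbb{P}}$ is weak convergence in probability conditionally on the data, in the topology of uniform convergence on compacta (for a function of the data alone converging to a deterministic function this is convergence in probability, uniformly on compacta). **Setup.** $I\subseteq\mathbb{R}$ is an interval, $\mathsf{x}$ an interior point of $I$, $\theta_0:I\to\mathbb{R}$ is non-decreasing, $\Phi_0$ is non-negative, non-decreasing and continuous on $I$, $\psi_0=\theta_0\circ\Phi_0^-$, $\Psi_0(x)=\int_0^x\psi_0(v)\,dv$, $\Gamma_0=\Psi_0\circ\Phi_0$. Let $q=\min\{j\in\{1,2,\dots\}:\partial^j\theta_0(\mathsf{x})\ne0\}$, $r_n=n^{q/(1+2q)}$, $a_n=n^{1/(1+2q)}$. Given estimators $(\widehat\Gamma_n,\widehat\Phi_n,\widehat u_n)$ (with $\widehat\Phi_n$ non-negative,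 non-decreasing, right-continuous on $I$), $$\widehat\theta_n(\mathsf{x})=\partial_-\mathsf{GCM}_{[0,\widehat u_n]}(\widehat\Gamma_n\circ\widehat\Phi_n^-)\circ\widehat\Phi_n(\mathsf{x}),\qquad \widehat\Upsilon_n=\widehat\Gamma_n-\widehat\theta_n(\mathsf{x})\widehat\Phi_n.$$ Define $\mathcal{D}_j(\mathsf{x})=0$ for $0\le j\le q-1$ and $$\mathcal{D}_j(\mathsf{x})=\frac{1}{(j+1)!}\sum_{k=q}^{j}\binom{j}{k}\partial^k\theta_0(\mathsf{x})\,\partial^{j+1-k}\Phi_0(\mathsf{x}),\qquad j=q,\dots,\lfloor s\rfloor$$ (these are the coefficients of $(x-\mathsf{x})^{j+1}$ in the Taylor expansion at $\mathsf{x}$ of $\Upsilon_0=\Gamma_0-\theta_0(\mathsf{x})\Phi_0$). Also $\mathcal{M}^q_{\mathsf{x}}(v)=\mathcal{D}_q(\mathsf{x})v^{q+1}$. Bias-reduced estimator: let the constants $c_1,\dots,c_{\underline{s}+1}$ be such that the $(\underline{s}+1)\times(\underline{s}+1)$ matrix with $(k,p)$ element $c_k^p$ is invertible, and let $\{\lambda^{\mathtt{BR}}_j(k):1\le k\le\underline{s}+1\}$ be defined by $\sum_{k=1}^{\underline{s}+1}\lambda^{\mathtt{BR}}_j(k)c_k^p=\mathbb{1}(p=j+1)$ for $p=1,\dots,\underline{s}+1$. For $j=1,\dots,\underline{s}$, $$\widetilde{\mathcal{D}}^{\mathtt{BR}}_{j,n}(\mathsf{x})=\epsilon_n^{-(j+1)}\sum_{k=1}^{\underline{s}+1}\lambda^{\mathtt{BR}}_j(k)\,[\widehat\Upsilon_n(\mathsf{x}+c_k\epsilon_n)-\widehat\Upsilon_n(\mathsf{x})].$$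 For $\eta>0$ let $$\widehat G_n(v;\eta)=\sqrt{n\eta^{-1}}\,[\widehat\Gamma_n(\mathsf{x}+v\eta)-\widehat\Gamma_n(\mathsf{x})-\Gamma_0(\mathsf{x}+v\eta)+\Gamma_0(\mathsf{x})]-\theta_0(\mathsf{x})\sqrt{n\eta^{-1}}\,[\widehat\Phi_n(\mathsf{x}+v\eta)-\widehat\Phi_n(\mathsf{x})-\Phi_0(\mathsf{x}+v\eta)+\Phi_0(\mathsf{x})],$$ $$\widehat R_n(v;\eta)=\eta^{-1}[\widehat\Phi_n(\mathsf{x}+v\eta)-\widehat\Phi_n(\mathsf{x})-\Phi_0(\mathsf{x}+v\eta)+\Phi_0(\mathsf{x})].$$ **Assumption A.** For some $\delta>0$ and some real $s\ge q$, with $I^\delta_{\mathsf{x}}=\{x:|x-\mathsf{x}|\le\delta\}$: (A1) $I$ is an interval and $I^\delta_{\mathsf{x}}\subseteq I$. (A2) $\theta_0$ is non-decreasing and bounded on $I$, and $\lfloor s\rfloor$ times continuously differentiable on $I^\delta_{\mathsf{x}}$ with $\sup_{x,x'\in I^\delta_{\mathsf{x}}}|\partial^{\lfloor s\rfloor}\theta_0(x)-\partial^{\lfloor s\rfloor}\theta_0(x')|/|x-x'|^{s-\lfloor s\rfloor}<\infty$. (A3) $\Phi_0$ is non-negative, non-decreasing, continuous and bounded on $I$, and $\lfloor s\rfloor-q+1$ times continuously differentiable on $I^\delta_{\mathsf{x}}$ with $\partial\Phi_0(\mathsf{x})\ne0$ and $\sup_{x,x'\in I^\delta_{\mathsf{x}}}|\partial^{\lfloor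 s\rfloor-q+1}\Phi_0(x)-\partial^{\lfloor s\rfloor-q+1}\Phi_0(x')|/|x-x'|^{s-\lfloor s\rfloor}<\infty$. **Assumption D.** For every sequence $\eta_n>0$ with $\eta_n=o(1)$ and $a_n^{-1}\eta_n^{-1}=O(1)$: $\widehat G_n(1;\eta_n)=O_{\mathbb{P}}(1)$ and $\widehat R_n(1;\eta_n)=O_{\mathbb{P}}(1)$.
   Formalization: The first display is proved only when a_n^{-1}ε_n^{-1}=O(1), and if some c_k<0, Assumption D is also required with v=-1 (increments to the left of x); without these the claim fails, since Assumption D controls only right increments at scales of at least order a_n^{-1}. *)

theory Defs
  imports
    "HOL-Probability.Probability"
    "HOL-Library.Landau_Symbols"
    "Jordan_Normal_Form.Matrix"
begin

definition big_OP :: "(nat \<Rightarrow> 'w measure) \<Rightarrow> (nat \<Rightarrow> 'w \<Rightarrow> real) \<Rightarrow> (nat \<Rightarrow> real) \<Rightarrow> bool" where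
  "big_OP M X b \<longleftrightarrow>
     (\<forall>e>0. \<exists>K. \<forall>\<^sub>F n in sequentially.
        measure (M n) {\<omega> \<in> space (M n). \<bar>X n \<omega>\<bar> > K * \<bar>b n\<bar>} \<le> e)"

definition small_oP1 :: "(nat \<Rightarrow> 'w measure) \<Rightarrow> (nat \<Rightarrow> 'w \<Rightarrow> real) \<Rightarrow> bool" where
  "small_oP1 M X \<longleftrightarrow>
     (\<forall>e>0. (\<lambda>n. measure (M n) {\<omega> \<in> space (M n). \<bar>X n \<omega>\<bar> > e}) \<longlonglongrightarrow> 0)"

text \<open>\<open>X\<^sub>n = O(d\<^sub>n) + O\<^sub>P(b\<^sub>n)\<close>: up to a deterministic sequence of order
  \<open>d\<^sub>n\<close>, the variable \<open>X\<^sub>n\<close> is of stochastic order \<open>b\<^sub>n\<close>.\<close>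

definition bigO_plus_OP ::
  "(nat \<Rightarrow> 'w measure) \<Rightarrow> (nat \<Rightarrow> 'w \<Rightarrow> real) \<Rightarrow> (nat \<Rightarrow> real) \<Rightarrow> (nat \<Rightarrow> real) \<Rightarrow> bool" where
  "bigO_plus_OP M X d b \<longleftrightarrow>
     (\<exists>r. r \<in> O(d) \<and> big_OP M (\<lambda>n \<omega>. X n \<omega> - r n) b)"

text \<open>Conditional weak convergence in probability, for functions of the data alone and a
  deterministic limit: convergence in probability, uniformly on compacta.\<close>

definition conv_ucc_in_prob ::
  "(nat \<Rightarrow> 'w measure) \<Rightarrow> (nat \<Rightarrow> 'w \<Rightarrow> real \<Rightarrow> real) \<Rightarrow> (real \<Rightarrow> real) \<Rightarrow> bool" where
  "conv_ucc_in_prob M X f \<longleftrightarrow>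
     (\<forall>C. compact C \<and> C \<noteq> {} \<longrightarrow> small_oP1 M (\<lambda>n \<omega>. SUP v\<in>C. \<bar>X n \<omega> v - f v\<bar>))"

text \<open>The generalized inverse takes values in the closure of \<open>I\<close> in the extended reals
  (it can be \<open>-\<infinity>\<close> or \<open>\<infinity>\<close> when \<open>I\<close> is unbounded); a function is evaluated
  at an infinite endpoint by its limit.\<close>

definition gen_inv :: "real set \<Rightarrow> (real \<Rightarrow> real) \<Rightarrow> real \<Rightarrow> ereal" where
  "gen_inv I f y =
     (if {u \<in> I. f u \<ge> y} = {} then Sup (ereal ` I) else Inf (ereal ` {u \<in> I. f u \<ge> y}))"

fun eval_ext :: "(real \<Rightarrow> real) \<Rightarrow> ereal \<Rightarrow> real" where
  "eval_ext f (ereal u) = f u"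
| "eval_ext f PInfty = Lim at_top f"
| "eval_ext f MInfty = Lim at_bot f"

definition GCM :: "real set \<Rightarrow> (real \<Rightarrow> real) \<Rightarrow> real \<Rightarrow> real" where
  "GCM J f y = (SUP g \<in> {g. convex_on J g \<and> (\<forall>z\<in>J. g z \<le> f z)}. g y)"

definition left_deriv :: "(real \<Rightarrow> real) \<Rightarrow> real \<Rightarrow> real" where
  "left_deriv f y = vector_derivative f (at_left y)"

definition theta_hat ::
  "real set \<Rightarrow> (real \<Rightarrow> real) \<Rightarrow> (real \<Rightarrow> real) \<Rightarrow> real \<Rightarrow> real \<Rightarrow> real" where
  "theta_hat I \<Gamma> \<Phi> u x = left_deriv (GCM {0..u} (\<lambda>y. eval_ext \<Gamma> (gen_inv I \<Phi> y))) (\<Phi> x)"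

definition psi0 :: "real set \<Rightarrow> (real \<Rightarrow> real) \<Rightarrow> (real \<Rightarrow> real) \<Rightarrow> real \<Rightarrow> real" where
  "psi0 I \<theta>0 \<Phi>0 v = eval_ext \<theta>0 (gen_inv I \<Phi>0 v)"

text \<open>Only arguments \<open>y \<ge> 0\<close> are relevant, as \<open>\<Phi>0\<close> is non-negative.\<close>

definition Psi0 :: "real set \<Rightarrow> (real \<Rightarrow> real) \<Rightarrow> (real \<Rightarrow> real) \<Rightarrow> real \<Rightarrow> real" where
  "Psi0 I \<theta>0 \<Phi>0 y = integral {0..y} (psi0 I \<theta>0 \<Phi>0)"

definition Gamma0 :: "real set \<Rightarrow> (real \<Rightarrow> real) \<Rightarrow> (real \<Rightarrow> real) \<Rightarrow> real \<Rightarrow> real" where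
  "Gamma0 I \<theta>0 \<Phi>0 = Psi0 I \<theta>0 \<Phi>0 \<circ> \<Phi>0"

definition Upsilon :: "(real \<Rightarrow> real) \<Rightarrow> (real \<Rightarrow> real) \<Rightarrow> real \<Rightarrow> real \<Rightarrow> real" where
  "Upsilon \<Gamma> \<Phi> t y = \<Gamma> y - t * \<Phi> y"

definition rate_r :: "nat \<Rightarrow> nat \<Rightarrow> real" where
  "rate_r q n = real n powr (real q / (1 + 2 * real q))"

definition rate_a :: "nat \<Rightarrow> nat \<Rightarrow> real" where
  "rate_a q n = real n powr (1 / (1 + 2 * real q))"

definition first_nonzero_deriv :: "(real \<Rightarrow> real) \<Rightarrow> real \<Rightarrow> nat \<Rightarrow> bool" where
  "first_nonzero_deriv f x q \<longleftrightarrow>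
     q \<in> {j. 1 \<le> j \<and> (deriv ^^ j) f x \<noteq> 0} \<and>
     (\<forall>j \<in> {j. 1 \<le> j \<and> (deriv ^^ j) f x \<noteq> 0}. q \<le> j)"

definition D_coef :: "(real \<Rightarrow> real) \<Rightarrow> (real \<Rightarrow> real) \<Rightarrow> real \<Rightarrow> nat \<Rightarrow> nat \<Rightarrow> real" where
  "D_coef \<theta>0 \<Phi>0 x q j =
     (if j < q then 0
      else 1 / fact (j + 1) *
        (\<Sum>k=q..j. real (j choose k) * (deriv ^^ k) \<theta>0 x * (deriv ^^ (j + 1 - k)) \<Phi>0 x))"

definition M_limit :: "(real \<Rightarrow> real) \<Rightarrow> (real \<Rightarrow> real) \<Rightarrow> real \<Rightarrow> nat \<Rightarrow> real \<Rightarrow> real" where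
  "M_limit \<theta>0 \<Phi>0 x q v = D_coef \<theta>0 \<Phi>0 x q q * v ^ (q + 1)"

definition BR_matrix :: "nat \<Rightarrow> (nat \<Rightarrow> real) \<Rightarrow> real mat" where
  "BR_matrix m c = Matrix.mat m m (\<lambda>(i, l). c (i + 1) ^ (l + 1))"

definition BR_weights :: "nat \<Rightarrow> (nat \<Rightarrow> real) \<Rightarrow> (nat \<Rightarrow> nat \<Rightarrow> real) \<Rightarrow> bool" where
  "BR_weights sb c lam \<longleftrightarrow>
     (\<forall>j\<in>{1..sb}. \<forall>p\<in>{1..sb+1}.
        (\<Sum>k=1..sb+1. lam j k * c k ^ p) = (if p = j + 1 then 1 else 0))"

definition D_BR ::
  "nat \<Rightarrow> (nat \<Rightarrow> real) \<Rightarrow> (nat \<Rightarrow> nat \<Rightarrow> real) \<Rightarrow> (real \<Rightarrow> real) \<Rightarrow> real \<Rightarrow> real \<Rightarrow> nat \<Rightarrow> real" where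
  "D_BR sb c lam \<Upsilon> x \<epsilon> j =
     1 / \<epsilon> ^ (j + 1) * (\<Sum>k=1..sb+1. lam j k * (\<Upsilon> (x + c k * \<epsilon>) - \<Upsilon> x))"

definition M_tilde :: "nat \<Rightarrow> (nat \<Rightarrow> real) \<Rightarrow> real \<Rightarrow> real" where
  "M_tilde qb D v = (\<Sum>l=1..(qb + 1) div 2. max (D (2*l - 1)) 0 * v ^ (2*l))"

text \<open>\<open>f\<close> is \<open>m\<close> times continuously differentiable on \<open>S\<close>, with \<open>m\<close>-th derivative
  satisfying a Hoelder-type bound with exponent \<open>\<alpha>\<close>; \<open>g j\<close> is the \<open>j\<close>-th derivative.
  Derivatives are relative to \<open>S\<close>, i.e. one-sided at the endpoints of a closed interval.
  Pairs \<open>y = y'\<close> contribute \<open>0\<close> to the supremum.\<close>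

definition holder_smooth_on :: "real set \<Rightarrow> nat \<Rightarrow> real \<Rightarrow> (real \<Rightarrow> real) \<Rightarrow> bool" where
  "holder_smooth_on S m \<alpha> f \<longleftrightarrow>
     (\<exists>g :: nat \<Rightarrow> real \<Rightarrow> real.
        (\<forall>y\<in>S. g 0 y = f y) \<and>
        (\<forall>j<m. \<forall>y\<in>S. (g j has_real_derivative g (Suc j) y) (at y within S)) \<and>
        continuous_on S (g m) \<and>
        bdd_above ((\<lambda>(y, y'). \<bar>g m y - g m y'\<bar> / \<bar>y - y'\<bar> powr \<alpha>) ` (S \<times> S)))"

definition assumption_A ::
  "real set \<Rightarrow> real \<Rightarrow> (real \<Rightarrow> real) \<Rightarrow> (real \<Rightarrow> real) \<Rightarrow> nat \<Rightarrow> real \<Rightarrow> bool" where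
  "assumption_A I x \<theta>0 \<Phi>0 q s \<longleftrightarrow>
     real q \<le> s \<and>
     (\<exists>\<delta>>0.
        is_interval I \<and> cball x \<delta> \<subseteq> I \<and>
        mono_on I \<theta>0 \<and> bounded (\<theta>0 ` I) \<and>
        holder_smooth_on (cball x \<delta>) (nat \<lfloor>s\<rfloor>) (s - \<lfloor>s\<rfloor>) \<theta>0 \<and>
        (\<forall>y\<in>I. \<Phi>0 y \<ge> 0) \<and> mono_on I \<Phi>0 \<and> continuous_on I \<Phi>0 \<and> bounded (\<Phi>0 ` I) \<and>
        holder_smooth_on (cball x \<delta>) (nat \<lfloor>s\<rfloor> - q + 1) (s - \<lfloor>s\<rfloor>) \<Phi>0 \<and>
        deriv \<Phi>0 x \<noteq> 0)"

definition diff_incr ::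
  "(real \<Rightarrow> real) \<Rightarrow> (real \<Rightarrow> real) \<Rightarrow> real \<Rightarrow> real \<Rightarrow> real" where
  "diff_incr f f0 x h = f (x + h) - f x - f0 (x + h) + f0 x"

definition G_hat ::
  "(real \<Rightarrow> real) \<Rightarrow> (real \<Rightarrow> real) \<Rightarrow> (real \<Rightarrow> real) \<Rightarrow> (real \<Rightarrow> real) \<Rightarrow> real \<Rightarrow> real \<Rightarrow> nat
     \<Rightarrow> real \<Rightarrow> real \<Rightarrow> real" where
  "G_hat \<Gamma> \<Phi> \<Gamma>0 \<Phi>0 t x n v \<eta> =
     sqrt (real n / \<eta>) * diff_incr \<Gamma> \<Gamma>0 x (v * \<eta>)
     - t * sqrt (real n / \<eta>) * diff_incr \<Phi> \<Phi>0 x (v * \<eta>)"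

definition R_hat :: "(real \<Rightarrow> real) \<Rightarrow> (real \<Rightarrow> real) \<Rightarrow> real \<Rightarrow> real \<Rightarrow> real \<Rightarrow> real" where
  "R_hat \<Phi> \<Phi>0 x v \<eta> = 1 / \<eta> * diff_incr \<Phi> \<Phi>0 x (v * \<eta>)"

text \<open>The increments are taken from \<open>x\<close> to \<open>x + v * \<eta>\<close>: to the right of \<open>x\<close>
  for \<open>v = 1\<close>, and to its left for \<open>v = -1\<close>.\<close>

definition assumption_D ::
  "(nat \<Rightarrow> 'w measure) \<Rightarrow> (nat \<Rightarrow> 'w \<Rightarrow> real \<Rightarrow> real) \<Rightarrow> (nat \<Rightarrow> 'w \<Rightarrow> real \<Rightarrow> real) \<Rightarrow>
     (real \<Rightarrow> real) \<Rightarrow> (real \<Rightarrow> real) \<Rightarrow> (real \<Rightarrow> real) \<Rightarrow> real \<Rightarrow> nat \<Rightarrow> real \<Rightarrow> bool" where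
  "assumption_D M \<Gamma>h \<Phi>h \<Gamma>0 \<Phi>0 \<theta>0 x q v \<longleftrightarrow>
     (\<forall>\<eta>. (\<forall>n. \<eta> n > 0) \<and> \<eta> \<in> o(\<lambda>_. 1) \<and> (\<lambda>n. 1 / (rate_a q n * \<eta> n)) \<in> O(\<lambda>_. 1) \<longrightarrow>
        big_OP M (\<lambda>n \<omega>. G_hat (\<Gamma>h n \<omega>) (\<Phi>h n \<omega>) \<Gamma>0 \<Phi>0 (\<theta>0 x) x n v (\<eta> n)) (\<lambda>_. 1) \<and>
        big_OP M (\<lambda>n \<omega>. R_hat (\<Phi>h n \<omega>) \<Phi>0 x v (\<eta> n)) (\<lambda>_. 1))"

end

theory Submission
  imports Defs
begin

text \<open>
  Near \<open>x\<close>, \<open>\<Gamma>\<^sub>0\<close> has derivative \<open>\<theta>\<^sub>0 \<cdot> \<Phi>\<^sub>0'\<close>: its increment over \<open>[u, w]\<close> lies between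
  \<open>\<theta>\<^sub>0(u) (\<Phi>\<^sub>0(w) - \<Phi>\<^sub>0(u))\<close> and \<open>\<theta>\<^sub>0(w) (\<Phi>\<^sub>0(w) - \<Phi>\<^sub>0(u))\<close>. Hence
  \<open>\<Upsilon>\<^sub>0' = (\<theta>\<^sub>0 - \<theta>\<^sub>0(x)) \<Phi>\<^sub>0'\<close>, and multiplying the Taylor expansions of the two factors gives an
  expansion of \<open>\<Upsilon>\<^sub>0\<close> with coefficients \<open>D\<^sub>j\<close> and remainder of order \<open>min(sb + 1, s) + 1\<close>, although
  \<open>\<Phi>\<^sub>0\<close> is less smooth than \<open>\<theta>\<^sub>0\<close>: the first factor vanishes to order \<open>q\<close>. The weights
  annihilate every monomial of the expansion except the one carrying \<open>D\<^sub>j\<close>; the remainder is the bias.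
  The stochastic part of an increment of the estimator is exactly
  \<open>sqrt(\<eta>/n) G - (\<theta>\<^sub>h - \<theta>\<^sub>0(x)) (\<eta> R + \<Phi>\<^sub>0(x \<plusminus> \<eta>) - \<Phi>\<^sub>0(x))\<close>, and \<open>n = a\<^sub>n^(1 + 2q)\<close> turns its order into
  powers of \<open>a\<^sub>n \<epsilon>\<^sub>n\<close>. Monotonicity of \<open>\<theta>\<^sub>0\<close> forces \<open>q\<close> odd and \<open>D\<^sub>q > 0\<close>, so that the term
  \<open>D\<^sub>q v^(q + 1)\<close> is present in \<open>M_tilde\<close> and survives the positive part.
\<close>

section \<open>Taylor expansion of Hoelder smooth functions\<close>

text \<open>The Lagrange remainder carries \<open>g p t\<close> at an intermediate point. Trading it
  for \<open>g p x\<close> costs the modulus of continuity at the centre, which adds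
  \<open>\<beta>\<close> to the exponent \<open>p\<close>.\<close>

lemma Taylor_bound:
  fixes g :: "nat \<Rightarrow> real \<Rightarrow> real"
  assumes deriv: "\<And>j y. j < p \<Longrightarrow> y \<in> ball x \<delta> \<Longrightarrow> (g j has_real_derivative g (Suc j) y) (at y)"
    and bound: "\<And>y. y \<in> ball x \<delta> \<Longrightarrow> \<bar>g p y - g p x\<bar> \<le> H * \<bar>y - x\<bar> powr \<beta>"
    and "0 \<le> \<beta>" "0 \<le> H" "y \<in> ball x \<delta>"
  shows "\<bar>g 0 y - (\<Sum>k\<le>p. g k x / fact k * (y - x) ^ k)\<bar> \<le> H * \<bar>y - x\<bar> powr (real p + \<beta>)"
\<comment> \<open>The Lagrange form requires a positive order and a point off the centre.\<close>
proof (cases "p = 0 \<or> y = x")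
  case True
  then show ?thesis
  proof
    assume "p = 0"
    then show ?thesis using bound[OF assms(5)] by simp
  next
    assume "y = x"
    have "(\<Sum>k\<le>p. g k x / fact k * (x - x) ^ k) = (\<Sum>k\<le>p. if k = 0 then g 0 x else 0)"
      by (intro sum.cong) auto
    then show ?thesis using \<open>y = x\<close> by simp
  qed
next
  case False
  define d where "d = \<bar>y - x\<bar>"
  have in_ball: "t \<in> ball x \<delta>" if "x - d \<le> t" "t \<le> x + d" for t
    using that assms(5) by (auto simp: d_def dist_real_def)
  \<comment> \<open>The interval \<open>[x - d, x + d]\<close> lies in the open ball and, being
    symmetric, serves both sides of \<open>x\<close>.\<close>
  have "\<exists>t. (if y < x then y < t \<and> t < x else x < t \<and> t < y) \<and>
    g 0 y = (\<Sum>m<p. (g m x / fact m) * (y - x)^m) + (g p t / fact p) * (y - x)^p"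
    using False by (intro Taylor[where a = "x - d" and b = "x + d"]) (auto intro!: deriv in_ball simp: d_def)
  then obtain t where t: "\<bar>t - x\<bar> \<le> d"
    "g 0 y = (\<Sum>m<p. (g m x / fact m) * (y - x)^m) + (g p t / fact p) * (y - x)^p"
    unfolding d_def by (smt (verit))
  have "g 0 y - (\<Sum>k\<le>p. g k x / fact k * (y - x) ^ k) = (g p t - g p x) / fact p * (y - x) ^ p"
    unfolding lessThan_Suc_atMost[symmetric] using t(2) by (simp add: diff_divide_distrib algebra_simps)
  then have "\<bar>g 0 y - (\<Sum>k\<le>p. g k x / fact k * (y - x) ^ k)\<bar> = \<bar>g p t - g p x\<bar> / fact p * d ^ p"
    by (simp add: abs_mult power_abs d_def)
  \<comment> \<open>The denominator \<open>1\<close> is a lower bound of \<open>fact p\<close>, in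
    the shape expected by \<open>frac_le\<close>.\<close>
  also have "\<dots> \<le> (H * d powr \<beta>) / 1 * d ^ p"
  proof (intro mult_right_mono frac_le)
    have "t \<in> ball x \<delta>" using t(1) by (intro in_ball) auto
    from bound[OF this] have "\<bar>g p t - g p x\<bar> \<le> H * \<bar>t - x\<bar> powr \<beta>" .
    also have "\<dots> \<le> H * d powr \<beta>"
      using t(1) assms by (intro mult_left_mono powr_mono2) auto
    finally show "\<bar>g p t - g p x\<bar> \<le> H * d powr \<beta>" .
  qed (use assms in \<open>auto simp: d_def\<close>)
  also have "\<dots> = H * d powr (real p + \<beta>)"
    using False by (simp add: powr_add powr_realpow d_def)
  finally show ?thesis by (simp add: d_def)
qed

text \<open>The smoothness class with its witnesses named. Agreement with the iterated
  \<open>deriv\<close> is asked in the open ball only, because derivatives at the boundary points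
  are one-sided.\<close>

definition holder_jet ::
  "real \<Rightarrow> real \<Rightarrow> nat \<Rightarrow> real \<Rightarrow> (real \<Rightarrow> real) \<Rightarrow> (nat \<Rightarrow> real \<Rightarrow> real) \<Rightarrow> real \<Rightarrow> bool" where
  "holder_jet x \<delta> m \<alpha> f g H \<longleftrightarrow>
     (\<forall>k\<le>m. \<forall>y\<in>ball x \<delta>. g k y = (deriv ^^ k) f y) \<and>
     (\<forall>y\<in>cball x \<delta>. g 0 y = f y) \<and>
     (\<forall>j<m. \<forall>y\<in>cball x \<delta>. (g j has_real_derivative g (Suc j) y) (at y within cball x \<delta>)) \<and>
     (\<forall>j\<le>m. continuous_on (cball x \<delta>) (g j)) \<and>
     (\<forall>y\<in>cball x \<delta>. \<forall>y'\<in>cball x \<delta>. y \<noteq> y' \<longrightarrow> \<bar>g m y - g m y'\<bar> \<le> H * \<bar>y - y'\<bar> powr \<alpha>) \<and>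
     0 \<le> H"

lemma holder_jetD:
  assumes "holder_jet x \<delta> m \<alpha> f g H"
  shows "\<And>k y. k \<le> m \<Longrightarrow> y \<in> ball x \<delta> \<Longrightarrow> g k y = (deriv ^^ k) f y"
    "\<And>y. y \<in> cball x \<delta> \<Longrightarrow> g 0 y = f y"
    "\<And>j y. j < m \<Longrightarrow> y \<in> cball x \<delta> \<Longrightarrow> (g j has_real_derivative g (Suc j) y) (at y within cball x \<delta>)"
    "\<And>j. j \<le> m \<Longrightarrow> continuous_on (cball x \<delta>) (g j)"
    "\<And>y y'. y \<in> cball x \<delta> \<Longrightarrow> y' \<in> cball x \<delta> \<Longrightarrow> y \<noteq> y' \<Longrightarrow> \<bar>g m y - g m y'\<bar> \<le> H * \<bar>y - y'\<bar> powr \<alpha>"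
    "0 \<le> H"
  using assms unfolding holder_jet_def by blast+

text \<open>Inside the ball a derivative relative to the closed ball is an ordinary one, so the
  abstract jet must consist of the iterated \<open>deriv\<close>.\<close>

lemma holder_smooth_on_jet:
  assumes "holder_smooth_on (cball x \<delta>) m \<alpha> f" "0 < \<delta>"
  obtains g H where "holder_jet x \<delta> m \<alpha> f g H"
proof -
  let ?S = "cball x \<delta>"
  from assms(1) obtain g where g: "\<forall>y\<in>?S. g 0 y = f y"
    "\<forall>j<m. \<forall>y\<in>?S. (g j has_real_derivative g (Suc j) y) (at y within ?S)"
    "continuous_on ?S (g m)"
    "bdd_above ((\<lambda>(y, y'). \<bar>g m y - g m y'\<bar> / \<bar>y - y'\<bar> powr \<alpha>) ` (?S \<times> ?S))"
    unfolding holder_smooth_on_def by blast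
  from g(4) obtain H where H: "\<And>y y'. y \<in> ?S \<Longrightarrow> y' \<in> ?S \<Longrightarrow> \<bar>g m y - g m y'\<bar> / \<bar>y - y'\<bar> powr \<alpha> \<le> H"
    unfolding bdd_above_def by force
  \<comment> \<open>The diagonal pair contributes the quotient \<open>0\<close>.\<close>
  have "0 \<le> H" using H[of x x] assms by simp
  have at: "(g j has_real_derivative g (Suc j) y) (at y)" if "j < m" "y \<in> ball x \<delta>" for j y
  proof -
    have "(g j has_real_derivative g (Suc j) y) (at y within ball x \<delta>)"
      using g(2) that by (meson DERIV_subset ball_subset_cball subsetD)
    then show ?thesis using that by (simp add: at_within_open[OF _ open_ball])
  qed
  \<comment> \<open>The induction carries equality on the whole open ball, since
    \<open>deriv\<close> at a point sees a neighbourhood of it.\<close>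
  have eq: "\<forall>y\<in>ball x \<delta>. (deriv ^^ k) f y = g k y" if "k \<le> m" for k
    using that
  proof (induction k)
    case 0
    then show ?case using g(1) by auto
  next
    case (Suc k)
    show ?case
    proof
      fix y assume y: "y \<in> ball x \<delta>"
      have "\<forall>\<^sub>F z in nhds y. (deriv ^^ k) f z = g k z"
        using Suc y by (auto intro!: eventually_nhds_in_open[THEN eventually_mono, of "ball x \<delta>"])
      then have "deriv ((deriv ^^ k) f) y = deriv (g k) y" by (rule deriv_cong_ev) simp
      also have "\<dots> = g (Suc k) y" using at Suc.prems y by (intro DERIV_imp_deriv) auto
      finally show "(deriv ^^ Suc k) f y = g (Suc k) y" by simp
    qed
  qed
  have cont: "continuous_on ?S (g j)" if "j \<le> m" for j
  proof (cases "j = m")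
    case False
    then show ?thesis using g(2) that by (intro DERIV_continuous_on[of _ _ "g (Suc j)"]) auto
  qed (use g in simp)
  have "\<bar>g m y - g m y'\<bar> \<le> H * \<bar>y - y'\<bar> powr \<alpha>" if "y \<in> ?S" "y' \<in> ?S" "y \<noteq> y'" for y y'
    using H[OF that(1,2)] that(3) by (simp add: divide_simps)
  then have "holder_jet x \<delta> m \<alpha> f g H"
    unfolding holder_jet_def using g(1,2) eq cont \<open>0 \<le> H\<close> by simp
  then show thesis by (rule that)
qed

lemma holder_smooth_on_deriv_at:
  assumes "holder_smooth_on (cball x \<delta>) m \<alpha> f" "0 < \<delta>" "1 \<le> m" "y \<in> ball x \<delta>"
  shows "(f has_real_derivative deriv f y) (at y)"
proof -
  obtain g H where J: "holder_jet x \<delta> m \<alpha> f g H"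
    by (rule holder_smooth_on_jet[OF assms(1,2)])
  note g = holder_jetD[OF J]
  have "(g 0 has_real_derivative g 1 y) (at y within ball x \<delta>)"
    using g(3)[of 0 y] assms by (auto intro: DERIV_subset)
  then have "(g 0 has_real_derivative g 1 y) (at y)"
    using assms by (simp add: at_within_open[OF _ open_ball])
  then have "(f has_real_derivative g 1 y) (at y)"
    by (rule has_field_derivative_transform_within_open[OF _ open_ball assms(4)]) (use g(1)[of 0] in simp)
  then show ?thesis using g(1)[of 1 y] assms by simp
qed

lemma holder_smooth_on_continuous:
  assumes "holder_smooth_on (cball x \<delta>) m \<alpha> f" "0 < \<delta>"
  shows "continuous_on (cball x \<delta>) f"
proof -
  obtain g H where J: "holder_jet x \<delta> m \<alpha> f g H"
    by (rule holder_smooth_on_jet[OF assms])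
  note g = holder_jetD[OF J]
  show ?thesis using g(4)[of 0] g(2) by (simp cong: continuous_on_cong_simp)
qed

lemma holder_smooth_on_subset:
  assumes "holder_smooth_on S m \<alpha> f" "T \<subseteq> S"
  shows "holder_smooth_on T m \<alpha> f"
proof -
  from assms(1) obtain g where g: "\<forall>y\<in>S. g 0 y = f y"
    "\<forall>j<m. \<forall>y\<in>S. (g j has_real_derivative g (Suc j) y) (at y within S)"
    "continuous_on S (g m)"
    "bdd_above ((\<lambda>(y, y'). \<bar>g m y - g m y'\<bar> / \<bar>y - y'\<bar> powr \<alpha>) ` (S \<times> S))"
    unfolding holder_smooth_on_def by blast
  show ?thesis unfolding holder_smooth_on_def
  proof (intro exI[of _ g] conjI)
    show "continuous_on T (g m)" using g(3) assms(2) by (rule continuous_on_subset)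
    show "bdd_above ((\<lambda>(y, y'). \<bar>g m y - g m y'\<bar> / \<bar>y - y'\<bar> powr \<alpha>) ` (T \<times> T))"
      by (rule bdd_above_mono[OF g(4)]) (use assms(2) in auto)
    show "\<forall>j<m. \<forall>y\<in>T. (g j has_real_derivative g (Suc j) y) (at y within T)"
      using g(2) assms(2) by (meson DERIV_subset subsetD)
  qed (use g(1) assms(2) in auto)
qed

text \<open>Shifts the jet by one. The radius shrinks because \<open>deriv f\<close> is identified
  with the second jet entry only in the open ball.\<close>

lemma holder_smooth_on_deriv:
  assumes "holder_smooth_on (cball x \<delta>) (Suc m) \<alpha> f" "0 < \<delta>'" "\<delta>' < \<delta>"
  shows "holder_smooth_on (cball x \<delta>') m \<alpha> (deriv f)"
proof -
  from assms have "0 < \<delta>" by simp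
  obtain g H where J: "holder_jet x \<delta> (Suc m) \<alpha> f g H"
    by (rule holder_smooth_on_jet[OF assms(1) \<open>0 < \<delta>\<close>])
  note g = holder_jetD[OF J]
  have sub: "cball x \<delta>' \<subseteq> cball x \<delta>" "cball x \<delta>' \<subseteq> ball x \<delta>" using assms by auto
  show ?thesis unfolding holder_smooth_on_def
  proof (intro exI[of _ "\<lambda>k. g (Suc k)"] conjI ballI allI impI)
    show "bdd_above ((\<lambda>(y, y'). \<bar>g (Suc m) y - g (Suc m) y'\<bar> / \<bar>y - y'\<bar> powr \<alpha>) ` (cball x \<delta>' \<times> cball x \<delta>'))"
    proof (rule bdd_aboveI2[of _ _ H], clarify)
      fix y y' assume "y \<in> cball x \<delta>'" "y' \<in> cball x \<delta>'"
      then show "\<bar>g (Suc m) y - g (Suc m) y'\<bar> / \<bar>y - y'\<bar> powr \<alpha> \<le> H"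
        using g(5)[of y y'] g(6) subsetD[OF sub(1), of y] subsetD[OF sub(1), of y'] by (cases "y = y'") (auto simp: divide_simps)
    qed
  next
    fix y assume "y \<in> cball x \<delta>'"
    then show "g (Suc 0) y = deriv f y" using g(1)[of "Suc 0" y] sub(2) by auto
  next
    fix j y assume "j < m" "y \<in> cball x \<delta>'"
    then show "(g (Suc j) has_real_derivative g (Suc (Suc j)) y) (at y within cball x \<delta>')"
      using g(3)[of "Suc j" y] sub(1) by (meson DERIV_subset Suc_less_eq subsetD)
  qed (use g(4) sub(1) in \<open>auto intro: continuous_on_subset\<close>)
qed

text \<open>At \<open>p = m\<close> the remainder exponent comes from the Hoelder bound on the top
  derivative. For \<open>p < m\<close> the next derivative is bounded on the compact ball, so the
  derivative of order \<open>p\<close> is Lipschitz and one full power is gained.\<close>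

lemma holder_smooth_on_Taylor:
  assumes "holder_smooth_on (cball x \<delta>) m \<alpha> f" "0 < \<delta>" "p \<le> m" "0 \<le> \<alpha>" "\<alpha> \<le> 1"
  obtains H where "0 \<le> H" "\<And>y. y \<in> ball x \<delta> \<Longrightarrow>
    \<bar>f y - (\<Sum>k\<le>p. (deriv ^^ k) f x / fact k * (y - x) ^ k)\<bar> \<le> H * \<bar>y - x\<bar> powr min (real p + 1) (real m + \<alpha>)"
proof -
  obtain g H0 where J: "holder_jet x \<delta> m \<alpha> f g H0"
    by (rule holder_smooth_on_jet[OF assms(1,2)])
  note g = holder_jetD[OF J]
  have at: "(g j has_real_derivative g (Suc j) y) (at y)" if "j < p" "y \<in> ball x \<delta>" for j y
  proof -
    have "(g j has_real_derivative g (Suc j) y) (at y within ball x \<delta>)"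
      using g(3)[of j y] that assms by (auto intro: DERIV_subset)
    then show ?thesis using that by (simp add: at_within_open[OF _ open_ball])
  qed
  \<comment> \<open>One modulus for both cases, with \<open>\<beta> = \<alpha>\<close> at the top
    order and \<open>\<beta> = 1\<close> below it.\<close>
  obtain H \<beta> where H: "0 \<le> H" "0 \<le> \<beta>" "real p + \<beta> = min (real p + 1) (real m + \<alpha>)"
    "\<And>y. y \<in> ball x \<delta> \<Longrightarrow> \<bar>g p y - g p x\<bar> \<le> H * \<bar>y - x\<bar> powr \<beta>"
  proof (cases "p = m")
    case True
    show thesis
    proof (rule that[of H0 \<alpha>])
      fix y assume "y \<in> ball x \<delta>"
      then show "\<bar>g p y - g p x\<bar> \<le> H0 * \<bar>y - x\<bar> powr \<alpha>"
        using g(5)[of y x] True assms g(6) by (cases "y = x") auto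
    qed (use assms True g in auto)
  next
    case False
    then have pm: "Suc p \<le> m" using assms by simp
    have "bounded (g (Suc p) ` cball x \<delta>)"
      using g(4)[OF pm] by (intro compact_imp_bounded compact_continuous_image) auto
    then obtain B where B: "\<And>y. y \<in> cball x \<delta> \<Longrightarrow> norm (g (Suc p) y) \<le> B"
      unfolding bounded_iff by blast
    have "0 \<le> B" using B[of x] assms(2) by (smt (verit) centre_in_cball norm_ge_zero)
    have "real p + 1 \<le> real m + \<alpha>" using pm assms by linarith
    show thesis
    proof (rule that[of B 1])
      fix y assume y: "y \<in> ball x \<delta>"
      have "norm (g p y - g p x) \<le> B * norm (y - x)"
        using g(3)[of p] pm B y assms(2)
        by (intro field_differentiable_bound[of "cball x \<delta>" "g p" "g (Suc p)"]) auto
      then show "\<bar>g p y - g p x\<bar> \<le> B * \<bar>y - x\<bar> powr 1" by (simp add: powr_one_gt_zero_iff)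
    qed (use \<open>0 \<le> B\<close> \<open>real p + 1 \<le> real m + \<alpha>\<close> in auto)
  qed
  show thesis
  proof (rule that[OF H(1)])
    fix y assume y: "y \<in> ball x \<delta>"
    have "\<bar>g 0 y - (\<Sum>k\<le>p. g k x / fact k * (y - x) ^ k)\<bar> \<le> H * \<bar>y - x\<bar> powr (real p + \<beta>)"
      by (rule Taylor_bound[where g = g and \<delta> = \<delta>]) (use at H y in auto)
    moreover have "g 0 y = f y" using g(1)[of 0 y] y by simp
    moreover have "(\<Sum>k\<le>p. g k x / fact k * (y - x) ^ k) = (\<Sum>k\<le>p. (deriv ^^ k) f x / fact k * (y - x) ^ k)"
      using g(1)[of _ x] assms by (intro sum.cong) auto
    ultimately show "\<bar>f y - (\<Sum>k\<le>p. (deriv ^^ k) f x / fact k * (y - x) ^ k)\<bar> \<le> H * \<bar>y - x\<bar> powr min (real p + 1) (real m + \<alpha>)"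
      using H(3) by simp
  qed
qed

section \<open>The primitive and its local expansion\<close>

text \<open>The point \<open>w\<close> belongs to the set whose infimum is taken, and the strict
  inequality at \<open>u\<close> keeps all points left of \<open>u\<close> out of it. The infimum is
  thus squeezed between two points of the interval.\<close>

lemma gen_inv_between:
  assumes "is_interval I" "mono_on I \<Phi>" "u \<in> I" "w \<in> I" "\<Phi> u < v" "v \<le> \<Phi> w"
  obtains z where "gen_inv I \<Phi> v = ereal z" "z \<in> I" "u \<le> z" "z \<le> w"
proof -
  let ?S = "{z \<in> I. \<Phi> z \<ge> v}"
  have w: "w \<in> ?S" using assms by simp
  have u: "u \<le> z" if "z \<in> ?S" for z
  proof (rule ccontr)
    assume "\<not> u \<le> z"
    then have "\<Phi> z \<le> \<Phi> u" using that assms by (intro mono_onD[OF assms(2)]) auto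
    then show False using that assms by simp
  qed
  have eq: "gen_inv I \<Phi> v = Inf (ereal ` ?S)" using w by (auto simp: gen_inv_def)
  have le: "Inf (ereal ` ?S) \<le> ereal w" using w by (intro INF_lower)
  have ge: "ereal u \<le> Inf (ereal ` ?S)" using u by (intro INF_greatest) auto
  obtain z where z: "Inf (ereal ` ?S) = ereal z"
    using le ge by (cases "Inf (ereal ` ?S)") auto
  have "u \<le> z" "z \<le> w" using le ge z by auto
  moreover have "z \<in> I" using assms calculation by (meson mem_is_interval_1_I)
  ultimately show thesis using that eq z by simp
qed

text \<open>Where the generalized inverse leaves \<open>I\<close> it equals the left endpoint, so \<open>psi0\<close>
  is monotone up to a constant on an initial segment.\<close>

lemma psi0_integrable:
  assumes I: "is_interval I" and \<theta>: "mono_on I \<theta>" "bounded (\<theta> ` I)" and u: "u \<in> I"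
  shows "psi0 I \<theta> \<Phi> integrable_on {0..\<Phi> u}"
proof -
  let ?S = "\<lambda>v. {z \<in> I. \<Phi> z \<ge> v}" and ?g = "gen_inv I \<Phi>"
  obtain B where B: "\<And>z. z \<in> I \<Longrightarrow> B \<le> \<theta> z"
    using bounded_imp_bdd_below[OF \<theta>(2)] unfolding bdd_below_def by blast
  \<comment> \<open>The endpoint value \<open>c\<close> may break monotonicity. Replacing it by the
    lower bound \<open>B\<close> makes \<open>h\<close> monotone, and the monotone indicator
    \<open>k\<close> puts \<open>c\<close> back.\<close>
  define c where "c = eval_ext \<theta> (Inf (ereal ` I))"
  define h where "h v = (if ?g v \<in> ereal ` I then \<theta> (real_of_ereal (?g v)) else B)" for v
  define k where "k v = (if ?g v \<in> ereal ` I then 1 else (0::real))" for v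
  have g: "?g v = Inf (ereal ` ?S v)" if "v \<le> \<Phi> u" for v
    using that u by (auto simp: gen_inv_def)
  have g_le: "?g v \<le> ereal u" if "v \<le> \<Phi> u" for v
    unfolding g[OF that] using that u by (intro INF_lower) auto
  have g_mono: "?g v \<le> ?g v'" if "v \<le> v'" "v' \<le> \<Phi> u" for v v'
    using that by (auto simp: g intro!: Inf_superset_mono)
  have in_I: "?g v' \<in> ereal ` I" if v: "v \<le> v'" "v' \<le> \<Phi> u" "?g v \<in> ereal ` I" for v v'
  proof -
    obtain z where z: "z \<in> I" "?g v = ereal z" using v(3) by auto
    have "ereal z \<le> ?g v'" "?g v' \<le> ereal u" using g_mono[OF v(1,2)] g_le[OF v(2)] z by auto
    then obtain z' where z': "?g v' = ereal z'" "z \<le> z'" "z' \<le> u" by (cases "?g v'") auto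
    then have "z' \<in> I" using z(1) u I by (meson mem_is_interval_1_I)
    then show ?thesis using z' by simp
  qed
  \<comment> \<open>The inverse is at most \<open>u\<close>, so if it were above a point of
    \<open>I\<close> it would itself lie in \<open>I\<close>.\<close>
  have out_I: "?g v = Inf (ereal ` I)" if v: "v \<le> \<Phi> u" "?g v \<notin> ereal ` I" for v
  proof (rule antisym)
    show "?g v \<le> Inf (ereal ` I)"
    proof (rule INF_greatest, rule ccontr)
      fix z assume z: "z \<in> I" "\<not> ?g v \<le> ereal z"
      then have "ereal z \<le> ?g v" by simp
      then obtain z' where "?g v = ereal z'" "z \<le> z'" "z' \<le> u"
        using g_le[OF v(1)] by (cases "?g v") auto
      then show False using v z(1) u I by (metis imageI mem_is_interval_1_I)
    qed
    show "Inf (ereal ` I) \<le> ?g v" unfolding g[OF v(1)] by (intro Inf_superset_mono) auto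
  qed
  have "mono_on {0..\<Phi> u} h"
  proof (rule mono_onI)
    fix v v' assume v: "v \<in> {0..\<Phi> u}" "v' \<in> {0..\<Phi> u}" "v \<le> v'"
    show "h v \<le> h v'"
    proof (cases "?g v \<in> ereal ` I")
      case True
      then have *: "?g v' \<in> ereal ` I" using in_I v by auto
      show ?thesis using True * g_mono[of v v'] v
        by (auto simp: h_def intro!: mono_onD[OF \<theta>(1)])
    next
      case False
      then show ?thesis using B by (auto simp: h_def)
    qed
  qed
  moreover have "mono_on {0..\<Phi> u} k"
    using in_I by (intro mono_onI) (auto simp: k_def)
  ultimately have "(\<lambda>v. h v + (c - B) * (1 - k v)) integrable_on {0..\<Phi> u}"
    by (intro integrable_add integrable_on_mult_right integrable_diff integrable_on_mono_on integrable_on_const) auto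
  moreover have "h v + (c - B) * (1 - k v) = psi0 I \<theta> \<Phi> v" if "v \<in> {0..\<Phi> u}" for v
    using that out_I[of v] by (auto simp: h_def k_def psi0_def c_def)
  ultimately show ?thesis by (rule integrable_eq)
qed

text \<open>The increment is the integral of \<open>psi0\<close> over
  \<open>[\<Phi> u, \<Phi> w]\<close>. There the generalized inverse takes values in
  \<open>[u, w]\<close>, and monotonicity of \<theta> bounds the integrand.\<close>

lemma Gamma0_increment_bounds:
  assumes I: "is_interval I" and \<theta>: "mono_on I \<theta>" "bounded (\<theta> ` I)"
    and \<Phi>: "mono_on I \<Phi>" "\<And>y. y \<in> I \<Longrightarrow> 0 \<le> \<Phi> y" and u: "u \<in> I" "w \<in> I" "u \<le> w"
  shows "\<theta> u * (\<Phi> w - \<Phi> u) \<le> Gamma0 I \<theta> \<Phi> w - Gamma0 I \<theta> \<Phi> u"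
    and "Gamma0 I \<theta> \<Phi> w - Gamma0 I \<theta> \<Phi> u \<le> \<theta> w * (\<Phi> w - \<Phi> u)"
proof -
  have le: "\<Phi> u \<le> \<Phi> w" "0 \<le> \<Phi> u" using u \<Phi> by (auto intro: mono_onD)
  note int = psi0_integrable[OF I \<theta> u(2), of \<Phi>]
  \<comment> \<open>At \<open>v = \<Phi> u\<close> the inverse can fall to the left of
    \<open>u\<close>, where \<theta> may be smaller; altering one point leaves the integral
    unchanged.\<close>
  define h where "h v = (if v = \<Phi> u then \<theta> u else psi0 I \<theta> \<Phi> v)" for v
  have "Gamma0 I \<theta> \<Phi> w - Gamma0 I \<theta> \<Phi> u = integral {\<Phi> u..\<Phi> w} (psi0 I \<theta> \<Phi>)"
    using Henstock_Kurzweil_Integration.integral_combine[OF le(2,1) int] by (simp add: Gamma0_def Psi0_def)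
  also have "\<dots> = integral {\<Phi> u..\<Phi> w} h"
    by (rule integral_spike[of "{\<Phi> u}"]) (auto simp: h_def)
  finally have eq: "Gamma0 I \<theta> \<Phi> w - Gamma0 I \<theta> \<Phi> u = integral {\<Phi> u..\<Phi> w} h" .
  have "psi0 I \<theta> \<Phi> integrable_on {\<Phi> u..\<Phi> w}"
    using integrable_on_subinterval[OF int] le by auto
  then have hint: "h integrable_on {\<Phi> u..\<Phi> w}"
    by (rule integrable_spike[of _ _ "{\<Phi> u}"]) (auto simp: h_def)
  have h: "\<theta> u \<le> h v \<and> h v \<le> \<theta> w" if "v \<in> {\<Phi> u..\<Phi> w}" for v
  proof (cases "v = \<Phi> u")
    case True
    then show ?thesis using u \<theta>(1) by (auto simp: h_def intro: mono_onD)
  next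
    case False
    then have "\<Phi> u < v" "v \<le> \<Phi> w" using that by auto
    then obtain z where "gen_inv I \<Phi> v = ereal z" "z \<in> I" "u \<le> z" "z \<le> w"
      by (rule gen_inv_between[OF I \<Phi>(1) u(1,2)])
    then show ?thesis using u False by (auto simp: h_def psi0_def intro!: mono_onD[OF \<theta>(1)])
  qed
  have "integral {\<Phi> u..\<Phi> w} (\<lambda>_. \<theta> u) \<le> integral {\<Phi> u..\<Phi> w} h"
    using h hint by (intro integral_le) auto
  then show "\<theta> u * (\<Phi> w - \<Phi> u) \<le> Gamma0 I \<theta> \<Phi> w - Gamma0 I \<theta> \<Phi> u"
    using le by (simp add: eq mult.commute)
  have "integral {\<Phi> u..\<Phi> w} h \<le> integral {\<Phi> u..\<Phi> w} (\<lambda>_. \<theta> w)"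
    using h hint by (intro integral_le) auto
  then show "Gamma0 I \<theta> \<Phi> w - Gamma0 I \<theta> \<Phi> u \<le> \<theta> w * (\<Phi> w - \<Phi> u)"
    using le by (simp add: eq mult.commute)
qed

text \<open>Both bounds in one form valid for either order of \<open>u\<close> and \<open>w\<close>.
  The error is a product of two increments, hence of smaller order than \<open>w - u\<close> where
  \<theta> is continuous and \<Phi> differentiable.\<close>

lemma Gamma0_increment:
  assumes I: "is_interval I" and \<theta>: "mono_on I \<theta>" "bounded (\<theta> ` I)"
    and \<Phi>: "mono_on I \<Phi>" "\<And>y. y \<in> I \<Longrightarrow> 0 \<le> \<Phi> y" and u: "u \<in> I" "w \<in> I"
  shows "\<bar>Gamma0 I \<theta> \<Phi> w - Gamma0 I \<theta> \<Phi> u - \<theta> u * (\<Phi> w - \<Phi> u)\<bar> \<le> \<bar>\<theta> w - \<theta> u\<bar> * \<bar>\<Phi> w - \<Phi> u\<bar>"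
proof (cases "u \<le> w")
  case True
  note b = Gamma0_increment_bounds[OF I \<theta> \<Phi> u True]
  have "\<theta> u \<le> \<theta> w" "\<Phi> u \<le> \<Phi> w"
    using True u \<theta> \<Phi> by (auto dest: mono_onD)
  then have "\<bar>\<theta> w - \<theta> u\<bar> * \<bar>\<Phi> w - \<Phi> u\<bar> = (\<theta> w - \<theta> u) * (\<Phi> w - \<Phi> u)" by simp
  then show ?thesis using b by (simp add: algebra_simps)
next
  case False
  then have "w \<le> u" by simp
  note b = Gamma0_increment_bounds[OF I \<theta> \<Phi> u(2,1) this]
  have "\<theta> w \<le> \<theta> u" "\<Phi> w \<le> \<Phi> u"
    using \<open>w \<le> u\<close> u \<theta> \<Phi> by (auto dest: mono_onD)
  then have "\<bar>\<theta> w - \<theta> u\<bar> * \<bar>\<Phi> w - \<Phi> u\<bar> = (\<theta> u - \<theta> w) * (\<Phi> u - \<Phi> w)" by simp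
  then show ?thesis using b by (simp add: algebra_simps)
qed

text \<open>The difference quotient of \<open>Gamma0\<close> differs from \<open>\<theta> u\<close>
  times that of \<Phi> by at most the oscillation of \<theta> times a convergent quantity.\<close>

lemma Gamma0_has_derivative:
  assumes I: "is_interval I" and \<theta>: "mono_on I \<theta>" "bounded (\<theta> ` I)"
    and \<Phi>: "mono_on I \<Phi>" "\<And>y. y \<in> I \<Longrightarrow> 0 \<le> \<Phi> y" and u: "u \<in> interior I"
    and cont: "isCont \<theta> u" and deriv: "(\<Phi> has_real_derivative d) (at u)"
  shows "(Gamma0 I \<theta> \<Phi> has_real_derivative \<theta> u * d) (at u)"
proof -
  let ?G = "Gamma0 I \<theta> \<Phi>"
  have uI: "u \<in> I" using u interior_subset by blast
  have lim: "((\<lambda>w. (\<Phi> w - \<Phi> u) / (w - u)) \<longlongrightarrow> d) (at u)"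
    using deriv by (simp add: has_field_derivative_iff)
  have "((\<lambda>w. (?G w - ?G u) / (w - u) - \<theta> u * ((\<Phi> w - \<Phi> u) / (w - u))) \<longlongrightarrow> 0) (at u)"
  proof (rule Lim_null_comparison)
    show "((\<lambda>w. \<bar>\<theta> w - \<theta> u\<bar> * \<bar>(\<Phi> w - \<Phi> u) / (w - u)\<bar>) \<longlongrightarrow> 0) (at u)"
      using tendsto_mult[OF tendsto_rabs[OF tendsto_diff[OF cont[unfolded isCont_def] tendsto_const]] tendsto_rabs[OF lim],
          of "\<theta> u"] by simp
    have "\<forall>\<^sub>F w in at u. w \<in> interior I"
      using u by (intro eventually_at_in_open') auto
    then show "\<forall>\<^sub>F w in at u. norm ((?G w - ?G u) / (w - u) - \<theta> u * ((\<Phi> w - \<Phi> u) / (w - u)))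
       \<le> \<bar>\<theta> w - \<theta> u\<bar> * \<bar>(\<Phi> w - \<Phi> u) / (w - u)\<bar>"
    proof (rule eventually_mono)
      fix w assume "w \<in> interior I"
      then have "w \<in> I" using interior_subset by blast
      note b = Gamma0_increment[OF I \<theta> \<Phi> uI this]
      have "norm ((?G w - ?G u) / (w - u) - \<theta> u * ((\<Phi> w - \<Phi> u) / (w - u)))
        = \<bar>?G w - ?G u - \<theta> u * (\<Phi> w - \<Phi> u)\<bar> / \<bar>w - u\<bar>"
        by (simp add: diff_divide_distrib right_diff_distrib flip: abs_divide)
      also have "\<dots> \<le> \<bar>\<theta> w - \<theta> u\<bar> * \<bar>\<Phi> w - \<Phi> u\<bar> / \<bar>w - u\<bar>"
        using b by (intro divide_right_mono) auto
      finally show "norm ((?G w - ?G u) / (w - u) - \<theta> u * ((\<Phi> w - \<Phi> u) / (w - u)))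
       \<le> \<bar>\<theta> w - \<theta> u\<bar> * \<bar>(\<Phi> w - \<Phi> u) / (w - u)\<bar>" by (simp add: abs_divide)
    qed
  qed
  from tendsto_add[OF this tendsto_mult[OF tendsto_const[of "\<theta> u"] lim]]
  show ?thesis by (simp add: has_field_derivative_iff)
qed

section \<open>Products of Taylor expansions and the coefficients of the limit\<close>

lemma power_mult_powr_le:
  fixes t :: real
  assumes "\<bar>t\<bar> \<le> 1" "c \<le> real k + b"
  shows "\<bar>t\<bar> ^ k * \<bar>t\<bar> powr b \<le> \<bar>t\<bar> powr c"
proof (cases "t = 0")
  case False
  then have "\<bar>t\<bar> ^ k * \<bar>t\<bar> powr b = \<bar>t\<bar> powr (real k + b)"
    by (simp add: powr_add powr_realpow)
  then show ?thesis using powr_mono'[OF assms(2), of "\<bar>t\<bar>"] assms by simp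
qed simp

text \<open>Cauchy product truncated at total degree \<open>p\<close>, with
  \<open>j = k + i\<close>. Against the term of degree \<open>k\<close> the second factor is cut at
  degree \<open>p - k\<close>, so it is never expanded beyond degree \<open>p - q\<close>.\<close>

lemma sum_triangle_product:
  fixes a b :: "nat \<Rightarrow> real"
  shows "(\<Sum>j=q..p. (\<Sum>k=q..j. a k * b (j - k)) * t ^ j) = (\<Sum>k=q..p. a k * t ^ k * (\<Sum>i\<le>p - k. b i * t ^ i))"
proof -
  have "(\<Sum>j=q..p. (\<Sum>k=q..j. a k * b (j - k)) * t ^ j)
    = (\<Sum>(j, k)\<in>Sigma {q..p} (\<lambda>j. {q..j}). a k * b (j - k) * t ^ j)"
    by (simp add: sum.Sigma sum_distrib_right)
  also have "\<dots> = (\<Sum>(k, i)\<in>Sigma {q..p} (\<lambda>k. {..p - k}). a k * t ^ k * (b i * t ^ i))"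
    by (rule sum.reindex_bij_witness[of _ "\<lambda>(k, i). (k + i, k)" "\<lambda>(j, k). (k, j - k)"])
      (auto simp flip: power_add)
  also have "\<dots> = (\<Sum>k=q..p. a k * t ^ k * (\<Sum>i\<le>p - k. b i * t ^ i))"
    by (simp add: sum.Sigma sum_distrib_left)
  finally show ?thesis .
qed

text \<open>The error splits into the remainder of \<open>A\<close> times \<open>B\<close> and, for
  each \<open>k\<close>, the term \<open>a k * t ^ k\<close> times the remainder of \<open>B\<close>
  cut at degree \<open>p - k\<close>. The factor \<open>t ^ k\<close> makes up for the weaker
  expansion of \<open>B\<close>.\<close>

lemma product_expansion:
  fixes a b \<beta> H2 :: "nat \<Rightarrow> real"
  assumes A: "\<bar>A - (\<Sum>k=q..p. a k * t ^ k)\<bar> \<le> H1 * \<bar>t\<bar> powr \<kappa>"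
    and B: "\<And>k. k \<in> {q..p} \<Longrightarrow> \<bar>B - (\<Sum>i\<le>p - k. b i * t ^ i)\<bar> \<le> H2 k * \<bar>t\<bar> powr \<beta> k"
    and H: "\<And>k. k \<in> {q..p} \<Longrightarrow> 0 \<le> H2 k" "0 \<le> H1" "\<bar>B\<bar> \<le> HB"
    and \<beta>: "\<And>k. k \<in> {q..p} \<Longrightarrow> \<kappa> \<le> real k + \<beta> k" and t: "\<bar>t\<bar> \<le> 1"
  shows "\<bar>A * B - (\<Sum>j=q..p. (\<Sum>k=q..j. a k * b (j - k)) * t ^ j)\<bar>
    \<le> (H1 * HB + (\<Sum>k=q..p. \<bar>a k\<bar> * H2 k)) * \<bar>t\<bar> powr \<kappa>"
proof -
  let ?P = "\<Sum>k=q..p. a k * t ^ k" and ?R = "\<lambda>k. B - (\<Sum>i\<le>p - k. b i * t ^ i)"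
  have "A * B - (\<Sum>j=q..p. (\<Sum>k=q..j. a k * b (j - k)) * t ^ j)
    = (A - ?P) * B + (\<Sum>k=q..p. a k * t ^ k * ?R k)"
    unfolding sum_triangle_product by (simp add: algebra_simps sum_distrib_left sum_subtractf)
  also have "\<bar>\<dots>\<bar> \<le> \<bar>A - ?P\<bar> * \<bar>B\<bar> + (\<Sum>k=q..p. \<bar>a k * t ^ k * ?R k\<bar>)"
    by (intro order_trans[OF abs_triangle_ineq] add_mono sum_abs) (simp add: abs_mult)
  also have "\<dots> \<le> (H1 * \<bar>t\<bar> powr \<kappa>) * HB + (\<Sum>k=q..p. \<bar>a k\<bar> * H2 k * \<bar>t\<bar> powr \<kappa>)"
  proof (intro add_mono mult_mono sum_mono A H)
    fix k assume k: "k \<in> {q..p}"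
    have "\<bar>a k * t ^ k * ?R k\<bar> = \<bar>a k\<bar> * \<bar>t\<bar> ^ k * \<bar>?R k\<bar>"
      by (simp only: abs_mult power_abs)
    also have "\<dots> \<le> \<bar>a k\<bar> * \<bar>t\<bar> ^ k * (H2 k * \<bar>t\<bar> powr \<beta> k)"
      by (rule mult_left_mono[OF B[OF k]]) simp
    also have "\<dots> = \<bar>a k\<bar> * H2 k * (\<bar>t\<bar> ^ k * \<bar>t\<bar> powr \<beta> k)" by simp
    also have "\<dots> \<le> \<bar>a k\<bar> * H2 k * \<bar>t\<bar> powr \<kappa>"
      using \<beta>[OF k] H(1)[OF k] t by (intro mult_left_mono power_mult_powr_le) auto
    finally show "\<bar>a k * t ^ k * ?R k\<bar> \<le> \<bar>a k\<bar> * H2 k * \<bar>t\<bar> powr \<kappa>" .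
  qed (use H in auto)
  also have "\<dots> = (H1 * HB + (\<Sum>k=q..p. \<bar>a k\<bar> * H2 k)) * \<bar>t\<bar> powr \<kappa>"
    by (simp add: algebra_simps sum_distrib_left)
  finally show ?thesis .
qed

text \<open>Differentiating the term of degree \<open>j + 1\<close> brings down
  \<open>j + 1\<close>; what results is a coefficient of the Cauchy product of the expansions of
  \<theta> minus its value at \<open>x\<close> and of \<open>deriv \<Phi>\<close>.\<close>

lemma D_coef_eq:
  "real (j + 1) * D_coef \<theta> \<Phi> x q j
    = (\<Sum>k=q..j. (deriv ^^ k) \<theta> x / fact k * ((deriv ^^ (j - k)) (deriv \<Phi>) x / fact (j - k)))"
proof -
  \<comment> \<open>For \<open>j < q\<close> the sum is empty, in agreement with the default value
    \<open>0\<close>.\<close>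
  have "real (j + 1) * D_coef \<theta> \<Phi> x q j
    = real (j + 1) / fact (j + 1) * (\<Sum>k=q..j. real (j choose k) * (deriv ^^ k) \<theta> x * (deriv ^^ (j + 1 - k)) \<Phi> x)"
    by (simp add: D_coef_def)
  also have "real (j + 1) / fact (j + 1) = 1 / fact j"
    by (simp add: fact_reduce divide_simps)
  also have "1 / fact j * (\<Sum>k=q..j. real (j choose k) * (deriv ^^ k) \<theta> x * (deriv ^^ (j + 1 - k)) \<Phi> x)
    = (\<Sum>k=q..j. (deriv ^^ k) \<theta> x / fact k * ((deriv ^^ (j - k)) (deriv \<Phi>) x / fact (j - k)))"
    unfolding sum_distrib_left
  proof (rule sum.cong)
    fix k assume k: "k \<in> {q..j}"
    then have "j + 1 - k = Suc (j - k)" by auto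
    then have "(deriv ^^ (j + 1 - k)) \<Phi> x = (deriv ^^ (j - k)) (deriv \<Phi>) x"
      by (simp only: funpow_Suc_right o_apply)
    moreover have "real (j choose k) = fact j / (fact k * fact (j - k))"
      using k by (intro binomial_fact) auto
    ultimately show "1 / fact j * (real (j choose k) * (deriv ^^ k) \<theta> x * (deriv ^^ (j + 1 - k)) \<Phi> x)
      = (deriv ^^ k) \<theta> x / fact k * ((deriv ^^ (j - k)) (deriv \<Phi>) x / fact (j - k))"
      by simp
  qed simp
  finally show ?thesis .
qed

lemma first_nonzero_deriv_Taylor_sum:
  fixes t :: real
  assumes "first_nonzero_deriv \<theta> x q"
  shows "(\<Sum>k\<le>p. (deriv ^^ k) \<theta> x / fact k * t ^ k) = \<theta> x + (\<Sum>k=q..p. (deriv ^^ k) \<theta> x / fact k * t ^ k)"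
proof -
  have q: "1 \<le> q" "\<And>k. 1 \<le> k \<Longrightarrow> k < q \<Longrightarrow> (deriv ^^ k) \<theta> x = 0"
    using assms by (force simp: first_nonzero_deriv_def)+
  have "(\<Sum>k\<le>p. (deriv ^^ k) \<theta> x / fact k * t ^ k) = (\<Sum>k\<in>insert 0 {q..p}. (deriv ^^ k) \<theta> x / fact k * t ^ k)"
  proof (rule sum.mono_neutral_right)
    show "\<forall>k\<in>{..p} - insert 0 {q..p}. (deriv ^^ k) \<theta> x / fact k * t ^ k = 0"
    proof
      fix k assume "k \<in> {..p} - insert 0 {q..p}"
      then show "(deriv ^^ k) \<theta> x / fact k * t ^ k = 0" using q(2)[of k] by auto
    qed
  qed auto
  then show ?thesis using q(1) by simp
qed

lemma assumption_AE:
  assumes "assumption_A I x \<theta> \<Phi> q s"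
  obtains \<delta> m \<alpha> where "0 < \<delta>" "\<delta> \<le> 1" "is_interval I" "cball x \<delta> \<subseteq> I" "mono_on I \<theta>" "bounded (\<theta> ` I)"
    "mono_on I \<Phi>" "\<forall>y\<in>I. 0 \<le> \<Phi> y" "deriv \<Phi> x \<noteq> 0" "s = real m + \<alpha>" "0 \<le> \<alpha>" "\<alpha> < 1" "q \<le> m"
    "holder_smooth_on (cball x \<delta>) m \<alpha> \<theta>" "holder_smooth_on (cball x \<delta>) (m - q) \<alpha> (deriv \<Phi>)"
    "\<forall>y\<in>ball x \<delta>. (\<Phi> has_real_derivative deriv \<Phi> y) (at y)"
    "\<forall>y\<in>ball x \<delta>. isCont \<theta> y"
proof -
  define m \<alpha> where "m = nat \<lfloor>s\<rfloor>" and "\<alpha> = s - \<lfloor>s\<rfloor>"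
  from assms obtain d where d: "real q \<le> s" "0 < d" "is_interval I" "cball x d \<subseteq> I" "mono_on I \<theta>" "bounded (\<theta> ` I)"
    "holder_smooth_on (cball x d) m \<alpha> \<theta>" "\<forall>y\<in>I. \<Phi> y \<ge> 0" "mono_on I \<Phi>"
    "holder_smooth_on (cball x d) (m - q + 1) \<alpha> \<Phi>" "deriv \<Phi> x \<noteq> 0"
    by (auto simp: assumption_A_def m_def \<alpha>_def)
  \<comment> \<open>Halving puts the closed ball inside the open one, where \<open>deriv\<close>
    obeys the jet; the cap \<open>1\<close> lets lower powers dominate higher ones.\<close>
  define \<delta> where "\<delta> = min 1 (d / 2)"
  have \<delta>: "0 < \<delta>" "\<delta> \<le> 1" "\<delta> < d" using d by (auto simp: \<delta>_def)
  then have sub: "cball x \<delta> \<subseteq> cball x d" "ball x \<delta> \<subseteq> ball x d" by auto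
  have s: "s = real m + \<alpha>" "0 \<le> \<alpha>" "\<alpha> < 1" "q \<le> m"
    using d(1) by (auto simp: m_def \<alpha>_def) linarith+
  show thesis
  proof (rule that[of \<delta> m \<alpha>])
    show "cball x \<delta> \<subseteq> I" using sub d by blast
    show "holder_smooth_on (cball x \<delta>) (m - q) \<alpha> (deriv \<Phi>)"
      using d(10) \<delta> by (intro holder_smooth_on_deriv[of x d]) auto
    show "holder_smooth_on (cball x \<delta>) m \<alpha> \<theta>"
      by (rule holder_smooth_on_subset[OF d(7) sub(1)])
    show "\<forall>y\<in>ball x \<delta>. (\<Phi> has_real_derivative deriv \<Phi> y) (at y)"
      using holder_smooth_on_deriv_at[OF d(10,2)] sub by auto
    show "\<forall>y\<in>ball x \<delta>. isCont \<theta> y"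
    proof -
      have "continuous_on (ball x d) \<theta>"
        using holder_smooth_on_continuous[OF d(7,2)] by (rule continuous_on_subset) auto
      then show ?thesis using sub by (auto simp: continuous_on_eq_continuous_at)
    qed
  qed (use d \<delta> s in auto)
qed

text \<open>The expansion is proved for the derivative and carried to \<open>\<Upsilon>\<close> by
  the mean value inequality on the ball of radius \<open>|h|\<close>, which raises the exponent by
  one. The Lipschitz bound on \<Phi> serves the part of the noise that stems from the estimated
  slope.\<close>

lemma Upsilon0_expansion:
  assumes A: "assumption_A I x \<theta> \<Phi> q s" and q: "first_nonzero_deriv \<theta> x q"
    and p: "q \<le> p" "real p < s"
  defines "\<Upsilon> \<equiv> Upsilon (Gamma0 I \<theta> \<Phi>) \<Phi> (\<theta> x)"
  obtains \<delta> C L where "0 < \<delta>"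
    "\<forall>h. \<bar>h\<bar> < \<delta> \<longrightarrow> \<bar>\<Upsilon> (x + h) - \<Upsilon> x - (\<Sum>j=1..p. D_coef \<theta> \<Phi> x q j * h ^ (j + 1))\<bar>
        \<le> C * \<bar>h\<bar> powr (min (real p + 1) s + 1)"
    "\<forall>h. \<bar>h\<bar> < \<delta> \<longrightarrow> \<bar>\<Phi> (x + h) - \<Phi> x\<bar> \<le> L * \<bar>h\<bar>"
proof -
  obtain \<delta> m \<alpha> where A: "0 < \<delta>" "\<delta> \<le> 1" "is_interval I" "cball x \<delta> \<subseteq> I" "mono_on I \<theta>" "bounded (\<theta> ` I)"
    "mono_on I \<Phi>" "\<forall>y\<in>I. 0 \<le> \<Phi> y" "deriv \<Phi> x \<noteq> 0" "s = real m + \<alpha>" "0 \<le> \<alpha>" "\<alpha> < 1" "q \<le> m"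
    "holder_smooth_on (cball x \<delta>) m \<alpha> \<theta>" "holder_smooth_on (cball x \<delta>) (m - q) \<alpha> (deriv \<Phi>)"
    and deriv: "\<forall>y\<in>ball x \<delta>. (\<Phi> has_real_derivative deriv \<Phi> y) (at y)"
    and cont: "\<forall>y\<in>ball x \<delta>. isCont \<theta> y"
    by (rule assumption_AE[OF A])
  define \<kappa> where "\<kappa> = min (real p + 1) s"
  define a where "a k = (deriv ^^ k) \<theta> x / fact k" for k
  define b where "b k = (deriv ^^ k) (deriv \<Phi>) x / fact k" for k
  have pm: "p \<le> m" using p(2) A by linarith
  obtain H1 where H1: "0 \<le> H1" "\<And>y. y \<in> ball x \<delta> \<Longrightarrow>
    \<bar>\<theta> y - (\<Sum>k\<le>p. a k * (y - x) ^ k)\<bar> \<le> H1 * \<bar>y - x\<bar> powr \<kappa>"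
    using holder_smooth_on_Taylor[OF A(14,1) pm A(11)] A(12) unfolding a_def \<kappa>_def A(10) by auto
  \<comment> \<open>Remainder exponent of \<open>deriv \<Phi>\<close> expanded to degree
    \<open>p - k\<close>. Since \<open>k \<ge> q\<close>, the sum \<open>k + \<beta> k\<close> is at
    least \<open>\<kappa>\<close>, which recovers the \<open>q\<close> missing derivatives.\<close>
  define \<beta> where "\<beta> k = min (real (p - k) + 1) (real (m - q) + \<alpha>)" for k
  \<comment> \<open>Stated as a predicate so that one constant for each \<open>k\<close> can be
    chosen at once.\<close>
  define Q where "Q k H \<longleftrightarrow> 0 \<le> H \<and> (\<forall>y\<in>ball x \<delta>. \<bar>deriv \<Phi> y - (\<Sum>i\<le>p - k. b i * (y - x) ^ i)\<bar>
      \<le> H * \<bar>y - x\<bar> powr \<beta> k)" for k H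
  have "\<exists>H. Q k H" if k: "k \<in> {q..p}" for k
  proof -
    have pk: "p - k \<le> m - q" using pm k by auto
    obtain H where "0 \<le> H" "\<And>y. y \<in> ball x \<delta> \<Longrightarrow> \<bar>deriv \<Phi> y - (\<Sum>i\<le>p - k. b i * (y - x) ^ i)\<bar>
      \<le> H * \<bar>y - x\<bar> powr \<beta> k"
      using holder_smooth_on_Taylor[OF A(15,1) pk A(11)] A(12) unfolding b_def \<beta>_def by auto
    then show ?thesis unfolding Q_def by blast
  qed
  then have "\<forall>k\<in>{q..p}. \<exists>H. Q k H" by blast
  then obtain H2 where "\<forall>k\<in>{q..p}. Q k (H2 k)" using bchoice[of "{q..p}" Q] by blast
  then have H2: "0 \<le> H2 k" "y \<in> ball x \<delta> \<Longrightarrow>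
    \<bar>deriv \<Phi> y - (\<Sum>i\<le>p - k. b i * (y - x) ^ i)\<bar> \<le> H2 k * \<bar>y - x\<bar> powr \<beta> k"
    if "k \<in> {q..p}" for k y
    using that by (auto simp: Q_def)
  have "bounded (deriv \<Phi> ` cball x \<delta>)"
    using holder_smooth_on_continuous[OF A(15,1)] by (intro compact_imp_bounded compact_continuous_image) auto
  then obtain HB where "\<forall>y\<in>cball x \<delta>. \<bar>deriv \<Phi> y\<bar> \<le> HB"
    unfolding bounded_iff by auto
  then have HB: "\<bar>deriv \<Phi> y\<bar> \<le> HB" if "y \<in> cball x \<delta>" for y using that by blast
  have "0 \<le> HB" using HB[of x] A(1) by (smt (verit) centre_in_cball)
  define C where "C = H1 * HB + (\<Sum>k=q..p. \<bar>a k\<bar> * H2 k)"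
  have C: "0 \<le> C" unfolding C_def using H1 H2 \<open>0 \<le> HB\<close> by (intro add_nonneg_nonneg sum_nonneg mult_nonneg_nonneg) auto
  define F where "F y = \<Upsilon> y - (\<Sum>j=1..p. D_coef \<theta> \<Phi> x q j * (y - x) ^ (j + 1))" for y
  define F' where "F' y = (\<theta> y - \<theta> x) * deriv \<Phi> y - (\<Sum>j=q..p. (\<Sum>k=q..j. a k * b (j - k)) * (y - x) ^ j)" for y
  have F: "(F has_real_derivative F' y) (at y)" if y: "y \<in> ball x \<delta>" for y
  proof -
    have "y \<in> interior I" using y A(4) by (meson ball_subset_cball interior_maximal open_ball order_trans subsetD)
    have "((\<lambda>y. \<Sum>j=1..p. D_coef \<theta> \<Phi> x q j * (y - x) ^ (j + 1)) has_real_derivative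
        (\<Sum>j=1..p. (real (j + 1) * D_coef \<theta> \<Phi> x q j) * (y - x) ^ j)) (at y)"
      by (auto intro!: derivative_eq_intros sum.cong simp del: power_Suc)
    also have "(\<Sum>j=1..p. (real (j + 1) * D_coef \<theta> \<Phi> x q j) * (y - x) ^ j)
       = (\<Sum>j=q..p. (real (j + 1) * D_coef \<theta> \<Phi> x q j) * (y - x) ^ j)"
      using q by (intro sum.mono_neutral_right) (auto simp: D_coef_def first_nonzero_deriv_def)
    also have "\<dots> = (\<Sum>j=q..p. (\<Sum>k=q..j. a k * b (j - k)) * (y - x) ^ j)"
      unfolding D_coef_eq a_def b_def ..
    finally have 1: "((\<lambda>y. \<Sum>j=1..p. D_coef \<theta> \<Phi> x q j * (y - x) ^ (j + 1)) has_real_derivative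
        (\<Sum>j=q..p. (\<Sum>k=q..j. a k * b (j - k)) * (y - x) ^ j)) (at y)" .
    have 2: "(Gamma0 I \<theta> \<Phi> has_real_derivative \<theta> y * deriv \<Phi> y) (at y)"
      using A(3,5-8) \<open>y \<in> interior I\<close> cont deriv y by (intro Gamma0_has_derivative) auto
    show ?thesis unfolding F_def F'_def \<Upsilon>_def Upsilon_def
      by (rule derivative_eq_intros 1 2 bspec[OF deriv y] refl)+ (simp add: algebra_simps)
  qed
  have F': "\<bar>F' y\<bar> \<le> C * \<bar>y - x\<bar> powr \<kappa>" if y: "y \<in> ball x \<delta>" for y
    unfolding F'_def C_def
  proof (rule product_expansion)
    show "\<bar>\<theta> y - \<theta> x - (\<Sum>k=q..p. a k * (y - x) ^ k)\<bar> \<le> H1 * \<bar>y - x\<bar> powr \<kappa>"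
      using H1(2)[OF y] first_nonzero_deriv_Taylor_sum[OF q, where p = p and t = "y - x"] by (simp add: a_def)
    show "\<kappa> \<le> real k + \<beta> k" if "k \<in> {q..p}" for k
      using that A(10,13) by (auto simp: \<kappa>_def \<beta>_def of_nat_diff min_def)
    show "\<bar>deriv \<Phi> y\<bar> \<le> HB" using HB[of y] y by auto
    show "\<bar>y - x\<bar> \<le> 1" using y A(2) by (auto simp: dist_real_def)
  qed (use H1 H2 y in auto)
  have exp: "\<bar>\<Upsilon> (x + h) - \<Upsilon> x - (\<Sum>j=1..p. D_coef \<theta> \<Phi> x q j * h ^ (j + 1))\<bar>
        \<le> C * \<bar>h\<bar> powr (min (real p + 1) s + 1)"
    and lip: "\<bar>\<Phi> (x + h) - \<Phi> x\<bar> \<le> HB * \<bar>h\<bar>" if h: "\<bar>h\<bar> < \<delta>" for h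
  proof -
    have sub: "cball x \<bar>h\<bar> \<subseteq> ball x \<delta>" using h by auto
    have in_b: "x \<in> cball x \<bar>h\<bar>" "x + h \<in> cball x \<bar>h\<bar>" by (auto simp: dist_real_def)
    have "norm (\<Phi> (x + h) - \<Phi> x) \<le> HB * norm (x + h - x)"
    proof (intro field_differentiable_bound[where S = "cball x \<bar>h\<bar>" and f' = "deriv \<Phi>"])
      fix z assume "z \<in> cball x \<bar>h\<bar>"
      then have zb: "z \<in> ball x \<delta>" using sub by blast
      show "(\<Phi> has_real_derivative deriv \<Phi> z) (at z within cball x \<bar>h\<bar>)"
        using bspec[OF deriv zb] by (rule has_field_derivative_at_within)
      show "norm (deriv \<Phi> z) \<le> HB" using HB[of z] zb by simp
    qed (use in_b in auto)
    then show "\<bar>\<Phi> (x + h) - \<Phi> x\<bar> \<le> HB * \<bar>h\<bar>" by simp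
    have "norm (F (x + h) - F x) \<le> (C * \<bar>h\<bar> powr \<kappa>) * norm (x + h - x)"
    proof (intro field_differentiable_bound[where S = "cball x \<bar>h\<bar>" and f' = F'])
      fix z assume z: "z \<in> cball x \<bar>h\<bar>"
      then have zb: "z \<in> ball x \<delta>" using sub by blast
      show "(F has_real_derivative F' z) (at z within cball x \<bar>h\<bar>)"
        using F[OF zb] by (rule has_field_derivative_at_within)
      have "\<bar>z - x\<bar> powr \<kappa> \<le> \<bar>h\<bar> powr \<kappa>"
        using z p A(10,11) by (intro powr_mono2) (auto simp: \<kappa>_def dist_real_def)
      then have "C * \<bar>z - x\<bar> powr \<kappa> \<le> C * \<bar>h\<bar> powr \<kappa>" using C by (rule mult_left_mono)
      then show "norm (F' z) \<le> C * \<bar>h\<bar> powr \<kappa>" using F'[OF zb] by simp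
    qed (use in_b in auto)
    moreover have "F (x + h) - F x = \<Upsilon> (x + h) - \<Upsilon> x - (\<Sum>j=1..p. D_coef \<theta> \<Phi> x q j * h ^ (j + 1))"
      by (simp add: F_def)
    \<comment> \<open>For nonzero \<open>h\<close> the factor \<open>|h|\<close> from the mean value
      inequality is absorbed into the power; at \<open>h = 0\<close> both sides vanish.\<close>
    ultimately show "\<bar>\<Upsilon> (x + h) - \<Upsilon> x - (\<Sum>j=1..p. D_coef \<theta> \<Phi> x q j * h ^ (j + 1))\<bar>
        \<le> C * \<bar>h\<bar> powr (min (real p + 1) s + 1)"
      by (cases "h = 0") (simp_all add: powr_add \<kappa>_def mult.assoc)
  qed
  show thesis by (rule that[of \<delta> C HB]) (use A exp lip in auto)
qed

section \<open>Parity of \<open>q\<close> and sign of the leading coefficient\<close>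

text \<open>The quotient of \<open>\<theta> y - \<theta> x\<close> by \<open>(y - x) ^ q\<close> has
  a nonzero limit. Monotonicity makes it non-negative on the right and, were \<open>q\<close> even,
  non-positive on the left, which is a contradiction. The sign of the coefficient follows since
  \<open>deriv \<Phi> x\<close> is non-negative and nonzero.\<close>

lemma leading_coefficient:
  assumes A: "assumption_A I x \<theta> \<Phi> q s" and q: "first_nonzero_deriv \<theta> x q" and qs: "real q < s"
  shows "odd q" "0 < D_coef \<theta> \<Phi> x q q"
proof -
  obtain \<delta> m \<alpha> where A: "0 < \<delta>" "\<delta> \<le> 1" "is_interval I" "cball x \<delta> \<subseteq> I" "mono_on I \<theta>" "bounded (\<theta> ` I)"
    "mono_on I \<Phi>" "\<forall>y\<in>I. 0 \<le> \<Phi> y" "deriv \<Phi> x \<noteq> 0" "s = real m + \<alpha>" "0 \<le> \<alpha>" "\<alpha> < 1" "q \<le> m"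
    "holder_smooth_on (cball x \<delta>) m \<alpha> \<theta>" "holder_smooth_on (cball x \<delta>) (m - q) \<alpha> (deriv \<Phi>)"
    "\<forall>y\<in>ball x \<delta>. (\<Phi> has_real_derivative deriv \<Phi> y) (at y)"
    "\<forall>y\<in>ball x \<delta>. isCont \<theta> y"
    by (rule assumption_AE[OF A])
  define L where "L = (deriv ^^ q) \<theta> x / fact q"
  have L: "L \<noteq> 0" using q by (simp add: L_def first_nonzero_deriv_def)
  \<comment> \<open>The strict inequality \<open>q < s\<close> makes the remainder vanish even after
    division by \<open>(y - x) ^ q\<close>.\<close>
  define \<kappa> where "\<kappa> = min (real q + 1) s"
  have \<kappa>: "0 < \<kappa> - real q" using qs by (simp add: \<kappa>_def)
  obtain H where H: "0 \<le> H" "\<And>y. y \<in> ball x \<delta> \<Longrightarrow>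
    \<bar>\<theta> y - (\<Sum>k\<le>q. (deriv ^^ k) \<theta> x / fact k * (y - x) ^ k)\<bar> \<le> H * \<bar>y - x\<bar> powr \<kappa>"
    using holder_smooth_on_Taylor[OF A(14,1,13,11)] A(12) unfolding \<kappa>_def A(10) by auto
  have b: "\<bar>(\<theta> y - \<theta> x) / (y - x) ^ q - L\<bar> \<le> H * \<bar>y - x\<bar> powr (\<kappa> - real q)"
    if y: "y \<in> ball x \<delta>" "y \<noteq> x" for y
  proof -
    have "\<bar>\<theta> y - \<theta> x - L * (y - x) ^ q\<bar> \<le> H * \<bar>y - x\<bar> powr \<kappa>"
      using H(2)[OF y(1)] first_nonzero_deriv_Taylor_sum[OF q, where p = q and t = "y - x"] by (simp add: L_def)
    moreover have "(\<theta> y - \<theta> x) / (y - x) ^ q - L = (\<theta> y - \<theta> x - L * (y - x) ^ q) / (y - x) ^ q"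
      using y by (simp add: field_simps)
    ultimately have "\<bar>(\<theta> y - \<theta> x) / (y - x) ^ q - L\<bar> \<le> H * \<bar>y - x\<bar> powr \<kappa> / \<bar>y - x\<bar> ^ q"
      by (simp add: abs_divide power_abs divide_right_mono)
    also have "\<dots> = H * \<bar>y - x\<bar> powr (\<kappa> - real q)"
      using y by (simp add: powr_diff powr_realpow)
    finally show ?thesis .
  qed
  have "((\<lambda>y. (\<theta> y - \<theta> x) / (y - x) ^ q - L) \<longlongrightarrow> 0) (at x)"
  proof (rule Lim_null_comparison)
    have "\<forall>\<^sub>F y in at x. y \<in> ball x \<delta>" using A(1) by (intro eventually_at_in_open') auto
    then show "\<forall>\<^sub>F y in at x. norm ((\<theta> y - \<theta> x) / (y - x) ^ q - L) \<le> H * \<bar>y - x\<bar> powr (\<kappa> - real q)"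
      using eventually_neq_at_within[of x x UNIV] by eventually_elim (use b in simp)
    have "((\<lambda>y. \<bar>y - x\<bar>) \<longlongrightarrow> 0) (at x)" by (auto intro!: tendsto_eq_intros)
    then have "((\<lambda>y. \<bar>y - x\<bar> powr (\<kappa> - real q)) \<longlongrightarrow> 0) (at x)"
      using \<kappa> by (intro tendsto_zero_powrI[OF _ tendsto_const]) auto
    then show "((\<lambda>y. H * \<bar>y - x\<bar> powr (\<kappa> - real q)) \<longlongrightarrow> 0) (at x)"
      by (rule tendsto_mult_right_zero)
  qed
  then have lim: "((\<lambda>y. (\<theta> y - \<theta> x) / (y - x) ^ q) \<longlongrightarrow> L) (at x)"
    by (rule Lim_null[THEN iffD2])
  have xI: "x \<in> I" using A(1,4) by auto
  have ev: "\<forall>\<^sub>F y in at x. y \<in> I"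
  proof (rule eventually_mono)
    show "\<forall>\<^sub>F y in at x. y \<in> ball x \<delta>" using A(1) by (intro eventually_at_in_open') auto
  qed (use A(4) in auto)
  have "0 \<le> L"
  proof (rule tendsto_lowerbound)
    show "((\<lambda>y. (\<theta> y - \<theta> x) / (y - x) ^ q) \<longlongrightarrow> L) (at_right x)"
      using lim by (simp add: filterlim_at_split)
    have "\<forall>\<^sub>F y in at_right x. y \<in> I" using ev by (simp add: eventually_at_split)
    then show "\<forall>\<^sub>F y in at_right x. 0 \<le> (\<theta> y - \<theta> x) / (y - x) ^ q"
      using eventually_at_right_less[of x] 
      by eventually_elim (use xI A(5) in \<open>auto intro!: divide_nonneg_nonneg dest: mono_onD\<close>)
  qed simp
  then have Lpos: "0 < L" using L by simp
  show "odd q"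
  proof
    assume "even q"
    have "L \<le> 0"
    proof (rule tendsto_upperbound)
      show "((\<lambda>y. (\<theta> y - \<theta> x) / (y - x) ^ q) \<longlongrightarrow> L) (at_left x)"
        using lim by (simp add: filterlim_at_split)
      have "\<forall>\<^sub>F y in at_left x. y \<in> I" using ev by (simp add: eventually_at_split)
      moreover have "\<forall>\<^sub>F y in at_left x. y < x" by (simp add: eventually_at_filter)
      ultimately show "\<forall>\<^sub>F y in at_left x. (\<theta> y - \<theta> x) / (y - x) ^ q \<le> 0"
        by eventually_elim (use xI A(5) \<open>even q\<close> in \<open>auto intro!: divide_nonpos_nonneg dest: mono_onD\<close>)
    qed simp
    then show False using Lpos by simp
  qed
  have "x \<in> interior I" using A(1,4) by (meson ball_subset_cball centre_in_ball interior_maximal open_ball order_trans subsetD)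
  then have "0 \<le> deriv \<Phi> x"
    using mono_on_imp_deriv_nonneg[OF A(7) bspec[OF A(16)]] A(1) \<open>x \<in> interior I\<close> by simp
  then have "0 < deriv \<Phi> x" using A(9) by simp
  \<comment> \<open>For \<open>j = q\<close> the Cauchy product has the single term
    \<open>k = q\<close>.\<close>
  moreover have "real (q + 1) * D_coef \<theta> \<Phi> x q q = L * deriv \<Phi> x"
    unfolding D_coef_eq by (simp add: L_def)
  ultimately show "0 < D_coef \<theta> \<Phi> x q q"
    using Lpos by (metis mult_pos_pos of_nat_0_le_iff zero_less_mult_pos2 mult.commute zero_less_mult_iff not_less)
qed

section \<open>Stochastic order\<close>

text \<open>The exceptional set is measurable even when the event \<open>P\<close> is not. As
  \<open>measure\<close> is \<open>0\<close> on non-measurable sets, measures of the raw events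
  could not be combined by a union bound.\<close>

definition outside_small :: "'w measure \<Rightarrow> real \<Rightarrow> ('w \<Rightarrow> bool) \<Rightarrow> bool" where
  "outside_small M e P \<longleftrightarrow> (\<exists>E\<in>sets M. measure M E \<le> e \<and> (\<forall>\<omega>\<in>space M - E. P \<omega>))"

lemma outside_small_mono:
  assumes "outside_small M e P" "e \<le> e'" "\<And>\<omega>. \<omega> \<in> space M \<Longrightarrow> P \<omega> \<Longrightarrow> Q \<omega>"
  shows "outside_small M e' Q"
proof -
  from assms(1) obtain E where E: "E \<in> sets M" "measure M E \<le> e" "\<forall>\<omega>\<in>space M - E. P \<omega>"
    by (auto simp: outside_small_def)
  then show ?thesis unfolding outside_small_def
    using assms(2,3) by (intro bexI[of _ E]) auto
qed

lemma outside_small_conj: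
  assumes "finite_measure M" "outside_small M e P" "outside_small M e' Q"
  shows "outside_small M (e + e') (\<lambda>\<omega>. P \<omega> \<and> Q \<omega>)"
proof -
  from assms obtain E E' where E: "E \<in> sets M" "measure M E \<le> e" "\<forall>\<omega>\<in>space M - E. P \<omega>"
    "E' \<in> sets M" "measure M E' \<le> e'" "\<forall>\<omega>\<in>space M - E'. Q \<omega>"
    by (auto simp: outside_small_def)
  have "measure M (E \<union> E') \<le> measure M E + measure M E'"
    using E by (intro measure_Un_le) auto
  then show ?thesis unfolding outside_small_def
    using E by (intro bexI[of _ "E \<union> E'"]) auto
qed

lemma outside_small_sure:
  assumes "0 \<le> e" "\<And>\<omega>. \<omega> \<in> space M \<Longrightarrow> P \<omega>"
  shows "outside_small M e P"
  using assms unfolding outside_small_def by (intro bexI[of _ "{}"]) auto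

text \<open>The failure set is covered by the measurable set \<open>E\<close>, so the bound is valid
  whether or not the failure set itself is measurable.\<close>

lemma outside_small_measure_le:
  assumes "finite_measure M" "outside_small M e P"
  shows "measure M {\<omega> \<in> space M. \<not> P \<omega>} \<le> e"
proof -
  from assms obtain E where E: "E \<in> sets M" "measure M E \<le> e" "\<forall>\<omega>\<in>space M - E. P \<omega>"
    by (auto simp: outside_small_def)
  have "measure M {\<omega> \<in> space M. \<not> P \<omega>} \<le> measure M E"
    using assms(1) E by (intro finite_measure.finite_measure_mono) auto
  then show ?thesis using E by simp
qed

section \<open>Stochastic boundedness and convergence through exceptional sets\<close>

text \<open>A version of \<open>big_OP\<close> that is closed under sums and products without
  measurability conditions on each intermediate variable. The sign of \<open>K\<close> is fixed so
  that bounds can be multiplied.\<close>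

definition bounded_in_prob ::
  "(nat \<Rightarrow> 'w measure) \<Rightarrow> (nat \<Rightarrow> 'w \<Rightarrow> real) \<Rightarrow> (nat \<Rightarrow> real) \<Rightarrow> bool" where
  "bounded_in_prob M X b \<longleftrightarrow>
     (\<forall>e>0. \<exists>K\<ge>0. \<forall>\<^sub>F n in sequentially. outside_small (M n) e (\<lambda>\<omega>. \<bar>X n \<omega>\<bar> \<le> K * \<bar>b n\<bar>))"

definition null_in_prob :: "(nat \<Rightarrow> 'w measure) \<Rightarrow> (nat \<Rightarrow> 'w \<Rightarrow> real) \<Rightarrow> bool" where
  "null_in_prob M X \<longleftrightarrow>
     (\<forall>e>0. \<forall>d>0. \<forall>\<^sub>F n in sequentially. outside_small (M n) d (\<lambda>\<omega>. \<bar>X n \<omega>\<bar> \<le> e))"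

text \<open>Measurability makes the set in \<open>big_OP\<close> itself an exceptional set. It is
  asked for large \<open>n\<close> only, since the evaluation points enter \<open>I\<close> only
  eventually.\<close>

lemma big_OP_imp_bounded_in_prob:
  assumes "big_OP M X b" "\<forall>\<^sub>F n in sequentially. X n \<in> borel_measurable (M n)"
  shows "bounded_in_prob M X b"
  unfolding bounded_in_prob_def
proof (intro allI impI)
  fix e :: real assume "0 < e"
  with assms(1) obtain K where K: "\<forall>\<^sub>F n in sequentially.
      measure (M n) {\<omega> \<in> space (M n). \<bar>X n \<omega>\<bar> > K * \<bar>b n\<bar>} \<le> e"
    unfolding big_OP_def by blast
  have "\<forall>\<^sub>F n in sequentially. outside_small (M n) e (\<lambda>\<omega>. \<bar>X n \<omega>\<bar> \<le> max K 0 * \<bar>b n\<bar>)"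
    using K assms(2)
  proof eventually_elim
    case (elim n)
    \<comment> \<open>The constant provided by \<open>big_OP\<close> carries no sign.\<close>
    have "K * \<bar>b n\<bar> \<le> max K 0 * \<bar>b n\<bar>" by (intro mult_right_mono) auto
    note [measurable] = elim(2)
    show ?case unfolding outside_small_def
    proof (intro bexI[of _ "{\<omega> \<in> space (M n). \<bar>X n \<omega>\<bar> > K * \<bar>b n\<bar>}"] conjI)
      show "{\<omega> \<in> space (M n). \<bar>X n \<omega>\<bar> > K * \<bar>b n\<bar>} \<in> sets (M n)" by measurable
    qed (use elim(1) \<open>K * \<bar>b n\<bar> \<le> max K 0 * \<bar>b n\<bar>\<close> in auto)
  qed
  then show "\<exists>K\<ge>0. \<forall>\<^sub>F n in sequentially. outside_small (M n) e (\<lambda>\<omega>. \<bar>X n \<omega>\<bar> \<le> K * \<bar>b n\<bar>)"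
    by (intro exI[of _ "max K 0"]) auto
qed

lemma bounded_in_prob_det: "bounded_in_prob M (\<lambda>n \<omega>. b n) b"
  unfolding bounded_in_prob_def by (auto intro!: exI[of _ 1] always_eventually outside_small_sure)

lemma bounded_in_prob_minus: "bounded_in_prob M X b \<Longrightarrow> bounded_in_prob M (\<lambda>n \<omega>. - X n \<omega>) b"
  by (simp add: bounded_in_prob_def)

lemma bounded_in_prob_cmult:
  assumes "bounded_in_prob M X b"
  shows "bounded_in_prob M (\<lambda>n \<omega>. t n * X n \<omega>) (\<lambda>n. t n * b n)"
  unfolding bounded_in_prob_def
proof (intro allI impI)
  fix e :: real assume "0 < e"
  with assms obtain K where "0 \<le> K" "\<forall>\<^sub>F n in sequentially. outside_small (M n) e (\<lambda>\<omega>. \<bar>X n \<omega>\<bar> \<le> K * \<bar>b n\<bar>)"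
    unfolding bounded_in_prob_def by blast
  then show "\<exists>K\<ge>0. \<forall>\<^sub>F n in sequentially. outside_small (M n) e (\<lambda>\<omega>. \<bar>t n * X n \<omega>\<bar> \<le> K * \<bar>t n * b n\<bar>)"
    by (intro exI[of _ K])
      (auto elim!: eventually_mono outside_small_mono simp: abs_mult mult.left_commute[of K] intro!: mult_left_mono)
qed

lemma bounded_in_prob_rate:
  assumes "bounded_in_prob M X b" "\<forall>\<^sub>F n in sequentially. \<bar>b n\<bar> \<le> C * \<bar>b' n\<bar>"
  shows "bounded_in_prob M X b'"
  unfolding bounded_in_prob_def
proof (intro allI impI)
  fix e :: real assume "0 < e"
  with assms obtain K where K: "0 \<le> K" "\<forall>\<^sub>F n in sequentially. outside_small (M n) e (\<lambda>\<omega>. \<bar>X n \<omega>\<bar> \<le> K * \<bar>b n\<bar>)"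
    unfolding bounded_in_prob_def by blast
  have "\<forall>\<^sub>F n in sequentially. outside_small (M n) e (\<lambda>\<omega>. \<bar>X n \<omega>\<bar> \<le> K * max C 0 * \<bar>b' n\<bar>)"
    using K(2) assms(2)
  proof eventually_elim
    case (elim n)
    have "C * \<bar>b' n\<bar> \<le> max C 0 * \<bar>b' n\<bar>" by (intro mult_right_mono) auto
    then have "K * \<bar>b n\<bar> \<le> K * (max C 0 * \<bar>b' n\<bar>)"
      using elim(2) K(1) by (intro mult_left_mono) auto
    then show ?case using elim(1) by (elim outside_small_mono) (auto simp: mult.assoc)
  qed
  then show "\<exists>K\<ge>0. \<forall>\<^sub>F n in sequentially. outside_small (M n) e (\<lambda>\<omega>. \<bar>X n \<omega>\<bar> \<le> K * \<bar>b' n\<bar>)"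
    using K(1) by (intro exI[of _ "K * max C 0"]) auto
qed

lemma bounded_in_prob_cong:
  assumes "bounded_in_prob M X b" "\<forall>\<^sub>F n in sequentially. \<forall>\<omega>\<in>space (M n). X n \<omega> = Y n \<omega>"
  shows "bounded_in_prob M Y b"
  unfolding bounded_in_prob_def
proof (intro allI impI)
  fix e :: real assume "0 < e"
  with assms obtain K where K: "0 \<le> K" "\<forall>\<^sub>F n in sequentially. outside_small (M n) e (\<lambda>\<omega>. \<bar>X n \<omega>\<bar> \<le> K * \<bar>b n\<bar>)"
    unfolding bounded_in_prob_def by blast
  have "\<forall>\<^sub>F n in sequentially. outside_small (M n) e (\<lambda>\<omega>. \<bar>Y n \<omega>\<bar> \<le> K * \<bar>b n\<bar>)"
    using K(2) assms(2) by eventually_elim (auto elim!: outside_small_mono)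
  with K(1) show "\<exists>K\<ge>0. \<forall>\<^sub>F n in sequentially. outside_small (M n) e (\<lambda>\<omega>. \<bar>Y n \<omega>\<bar> \<le> K * \<bar>b n\<bar>)"
    by blast
qed

lemma null_in_prob_cmult:
  assumes "null_in_prob M X"
  shows "null_in_prob M (\<lambda>n \<omega>. c * X n \<omega>)"
  unfolding null_in_prob_def
proof (intro allI impI)
  fix e d :: real assume *: "0 < e" "0 < d"
  \<comment> \<open>The summand \<open>1\<close> covers \<open>c = 0\<close>.\<close>
  then have "0 < e / (\<bar>c\<bar> + 1)" by (intro divide_pos_pos) auto
  then have "\<forall>\<^sub>F n in sequentially. outside_small (M n) d (\<lambda>\<omega>. \<bar>X n \<omega>\<bar> \<le> e / (\<bar>c\<bar> + 1))"
    using assms * unfolding null_in_prob_def by blast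
  then show "\<forall>\<^sub>F n in sequentially. outside_small (M n) d (\<lambda>\<omega>. \<bar>c * X n \<omega>\<bar> \<le> e)"
  proof (rule eventually_mono, elim outside_small_mono)
    fix n \<omega> assume "\<bar>X n \<omega>\<bar> \<le> e / (\<bar>c\<bar> + 1)"
    then have "(\<bar>c\<bar> + 1) * \<bar>X n \<omega>\<bar> \<le> e" by (simp add: field_simps)
    then show "\<bar>c * X n \<omega>\<bar> \<le> e" by (simp add: abs_mult algebra_simps)
  qed simp
qed

lemma null_in_prob_mono:
  assumes "null_in_prob M X" "\<forall>\<^sub>F n in sequentially. \<forall>\<omega>\<in>space (M n). \<bar>Y n \<omega>\<bar> \<le> \<bar>X n \<omega>\<bar>"
  shows "null_in_prob M Y"
  unfolding null_in_prob_def
proof (intro allI impI)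
  fix e d :: real assume *: "0 < e" "0 < d"
  then have "\<forall>\<^sub>F n in sequentially. outside_small (M n) d (\<lambda>\<omega>. \<bar>X n \<omega>\<bar> \<le> e)"
    using assms(1) unfolding null_in_prob_def by blast
  then show "\<forall>\<^sub>F n in sequentially. outside_small (M n) d (\<lambda>\<omega>. \<bar>Y n \<omega>\<bar> \<le> e)"
    using assms(2) by eventually_elim (auto elim!: outside_small_mono intro: order_trans)
qed

lemma null_in_prob_det:
  assumes "b \<longlonglongrightarrow> 0"
  shows "null_in_prob M (\<lambda>n \<omega>. b n)"
  unfolding null_in_prob_def
proof (intro allI impI)
  fix e d :: real assume *: "0 < e" "0 < d"
  have "\<forall>\<^sub>F n in sequentially. \<bar>b n\<bar> < e"
    using assms * by (auto simp: tendsto_iff dist_real_def)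
  then show "\<forall>\<^sub>F n in sequentially. outside_small (M n) d (\<lambda>\<omega>. \<bar>b n\<bar> \<le> e)"
    by (rule eventually_mono) (use * in \<open>auto intro: outside_small_sure\<close>)
qed

lemma bounded_in_prob_imp_null:
  assumes "bounded_in_prob M X b" "b \<longlonglongrightarrow> 0"
  shows "null_in_prob M X"
  unfolding null_in_prob_def
proof (intro allI impI)
  fix e d :: real assume *: "0 < e" "0 < d"
  then obtain K where K: "0 \<le> K" "\<forall>\<^sub>F n in sequentially. outside_small (M n) d (\<lambda>\<omega>. \<bar>X n \<omega>\<bar> \<le> K * \<bar>b n\<bar>)"
    using assms(1) unfolding bounded_in_prob_def by blast
  have "(\<lambda>n. K * \<bar>b n\<bar>) \<longlonglongrightarrow> 0" using assms(2) by (auto intro!: tendsto_eq_intros)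
  then have "\<forall>\<^sub>F n in sequentially. K * \<bar>b n\<bar> < e" using *(1) by (rule order_tendstoD)
  with K(2) show "\<forall>\<^sub>F n in sequentially. outside_small (M n) d (\<lambda>\<omega>. \<bar>X n \<omega>\<bar> \<le> e)"
    by eventually_elim (auto elim!: outside_small_mono)
qed

section \<open>Sums, products and the return to \<open>big_OP\<close> and
  \<open>small_oP1\<close>\<close>

context
  fixes M :: "nat \<Rightarrow> 'w measure"
  assumes finite_M: "\<And>n. finite_measure (M n)"
begin

lemma bounded_in_prob_imp_big_OP:
  assumes "bounded_in_prob M X b"
  shows "big_OP M X b"
  unfolding big_OP_def
proof (intro allI impI)
  fix e :: real assume "0 < e"
  with assms obtain K where "\<forall>\<^sub>F n in sequentially. outside_small (M n) e (\<lambda>\<omega>. \<bar>X n \<omega>\<bar> \<le> K * \<bar>b n\<bar>)"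
    unfolding bounded_in_prob_def by blast
  then have "\<forall>\<^sub>F n in sequentially. measure (M n) {\<omega> \<in> space (M n). \<bar>X n \<omega>\<bar> > K * \<bar>b n\<bar>} \<le> e"
    by (rule eventually_mono) (drule outside_small_measure_le[OF finite_M], simp add: not_le)
  then show "\<exists>K. \<forall>\<^sub>F n in sequentially. measure (M n) {\<omega> \<in> space (M n). \<bar>X n \<omega>\<bar> > K * \<bar>b n\<bar>} \<le> e"
    by blast
qed

lemma bounded_in_prob_add:
  assumes "bounded_in_prob M X b" "bounded_in_prob M Y b"
  shows "bounded_in_prob M (\<lambda>n \<omega>. X n \<omega> + Y n \<omega>) b"
  unfolding bounded_in_prob_def
proof (intro allI impI)
  fix e :: real assume "0 < e"
  then have e: "0 < e / 2" by simp
  obtain K where K: "0 \<le> K" "\<forall>\<^sub>F n in sequentially. outside_small (M n) (e / 2) (\<lambda>\<omega>. \<bar>X n \<omega>\<bar> \<le> K * \<bar>b n\<bar>)"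
    using assms(1) e unfolding bounded_in_prob_def by blast
  obtain K' where K': "0 \<le> K'" "\<forall>\<^sub>F n in sequentially. outside_small (M n) (e / 2) (\<lambda>\<omega>. \<bar>Y n \<omega>\<bar> \<le> K' * \<bar>b n\<bar>)"
    using assms(2) e unfolding bounded_in_prob_def by blast
  have "\<forall>\<^sub>F n in sequentially. outside_small (M n) e (\<lambda>\<omega>. \<bar>X n \<omega> + Y n \<omega>\<bar> \<le> (K + K') * \<bar>b n\<bar>)"
    using K(2) K'(2)
    by eventually_elim
      (drule (1) outside_small_conj[OF finite_M], erule outside_small_mono, auto simp: distrib_right)
  then show "\<exists>K\<ge>0. \<forall>\<^sub>F n in sequentially. outside_small (M n) e (\<lambda>\<omega>. \<bar>X n \<omega> + Y n \<omega>\<bar> \<le> K * \<bar>b n\<bar>)"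
    using K K' by (intro exI[of _ "K + K'"]) auto
qed

lemma bounded_in_prob_mult:
  assumes "bounded_in_prob M X b" "bounded_in_prob M Y b'"
  shows "bounded_in_prob M (\<lambda>n \<omega>. X n \<omega> * Y n \<omega>) (\<lambda>n. b n * b' n)"
  unfolding bounded_in_prob_def
proof (intro allI impI)
  fix e :: real assume "0 < e"
  then have e: "0 < e / 2" by simp
  obtain K where K: "0 \<le> K" "\<forall>\<^sub>F n in sequentially. outside_small (M n) (e / 2) (\<lambda>\<omega>. \<bar>X n \<omega>\<bar> \<le> K * \<bar>b n\<bar>)"
    using assms(1) e unfolding bounded_in_prob_def by blast
  obtain K' where K': "0 \<le> K'" "\<forall>\<^sub>F n in sequentially. outside_small (M n) (e / 2) (\<lambda>\<omega>. \<bar>Y n \<omega>\<bar> \<le> K' * \<bar>b' n\<bar>)"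
    using assms(2) e unfolding bounded_in_prob_def by blast
  have "\<forall>\<^sub>F n in sequentially. outside_small (M n) e (\<lambda>\<omega>. \<bar>X n \<omega> * Y n \<omega>\<bar> \<le> (K * K') * \<bar>b n * b' n\<bar>)"
    using K(2) K'(2)
  proof eventually_elim
    case (elim n)
    have *: "\<bar>X n \<omega> * Y n \<omega>\<bar> \<le> (K * K') * \<bar>b n * b' n\<bar>"
      if "\<bar>X n \<omega>\<bar> \<le> K * \<bar>b n\<bar> \<and> \<bar>Y n \<omega>\<bar> \<le> K' * \<bar>b' n\<bar>" for \<omega>
    proof -
      have "\<bar>X n \<omega>\<bar> * \<bar>Y n \<omega>\<bar> \<le> (K * \<bar>b n\<bar>) * (K' * \<bar>b' n\<bar>)"
        using that K(1) by (intro mult_mono) auto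
      then show ?thesis by (simp add: abs_mult mult_ac)
    qed
    show ?case
      using outside_small_conj[OF finite_M elim] by (rule outside_small_mono) (use * in auto)
  qed
  then show "\<exists>K\<ge>0. \<forall>\<^sub>F n in sequentially. outside_small (M n) e (\<lambda>\<omega>. \<bar>X n \<omega> * Y n \<omega>\<bar> \<le> K * \<bar>b n * b' n\<bar>)"
    using K K' by (intro exI[of _ "K * K'"]) auto
qed

lemma bounded_in_prob_sum:
  assumes "finite A" "\<And>k. k \<in> A \<Longrightarrow> bounded_in_prob M (X k) b"
  shows "bounded_in_prob M (\<lambda>n \<omega>. \<Sum>k\<in>A. X k n \<omega>) b"
  using assms
proof (induction A)
  case empty
  show ?case using bounded_in_prob_rate[OF bounded_in_prob_det[of M "\<lambda>_. 0"], of 0 b] by simp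
qed (auto intro: bounded_in_prob_add)

lemma null_in_prob_add:
  assumes "null_in_prob M X" "null_in_prob M Y"
  shows "null_in_prob M (\<lambda>n \<omega>. X n \<omega> + Y n \<omega>)"
  unfolding null_in_prob_def
proof (intro allI impI)
  fix e d :: real assume *: "0 < e" "0 < d"
  then have "0 < e / 2" "0 < d / 2" by auto
  then have "\<forall>\<^sub>F n in sequentially. outside_small (M n) (d / 2) (\<lambda>\<omega>. \<bar>X n \<omega>\<bar> \<le> e / 2)"
    "\<forall>\<^sub>F n in sequentially. outside_small (M n) (d / 2) (\<lambda>\<omega>. \<bar>Y n \<omega>\<bar> \<le> e / 2)"
    using assms unfolding null_in_prob_def by blast+
  then show "\<forall>\<^sub>F n in sequentially. outside_small (M n) d (\<lambda>\<omega>. \<bar>X n \<omega> + Y n \<omega>\<bar> \<le> e)"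
    by eventually_elim (drule (1) outside_small_conj[OF finite_M], erule outside_small_mono, auto)
qed

lemma null_in_prob_sum:
  assumes "finite A" "\<And>k. k \<in> A \<Longrightarrow> null_in_prob M (X k)"
  shows "null_in_prob M (\<lambda>n \<omega>. \<Sum>k\<in>A. X k n \<omega>)"
  using assms
proof (induction A)
  case empty
  show ?case using null_in_prob_det[of "\<lambda>_. 0" M] by simp
qed (auto intro: null_in_prob_add)

lemma null_in_prob_imp_small_oP1:
  assumes "null_in_prob M X"
  shows "small_oP1 M X"
  unfolding small_oP1_def
proof (intro allI impI)
  fix e :: real assume e: "0 < e"
  show "(\<lambda>n. measure (M n) {\<omega> \<in> space (M n). e < \<bar>X n \<omega>\<bar>}) \<longlonglongrightarrow> 0"
  proof (rule tendstoI)
    fix d :: real assume d: "0 < d"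
    then have "0 < d / 2" by simp
    then have "\<forall>\<^sub>F n in sequentially. outside_small (M n) (d / 2) (\<lambda>\<omega>. \<bar>X n \<omega>\<bar> \<le> e)"
      using assms e unfolding null_in_prob_def by blast
    then show "\<forall>\<^sub>F n in sequentially. dist (measure (M n) {\<omega> \<in> space (M n). e < \<bar>X n \<omega>\<bar>}) 0 < d"
      by (rule eventually_mono) (drule outside_small_measure_le[OF finite_M], use d in \<open>simp add: not_le\<close>)
  qed
qed

end

section \<open>The bias-reduced coefficients\<close>

text \<open>Here \<open>A\<close> stands for \<open>a n\<close> and \<open>e\<close> for
  \<open>\<epsilon> n\<close>, so that \<open>A powr (1 + 2 * q)\<close> is \<open>n\<close>. The
  second factor on the left is the order of the noise; after scaling only the product
  \<open>A * e\<close> remains.\<close>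

lemma rate_identity:
  assumes "0 < A" "0 < e"
  shows "A powr (q - real j) / e ^ (j + 1) * (sqrt (e / A powr (1 + 2 * q)) + e * A powr (- q))
    = (A * e) powr (- (real j + 1/2)) + (A * e) powr (- real j)"
proof -
  \<comment> \<open>In logarithmic coordinates both identities are linear relations between
    exponents.\<close>
  obtain \<alpha> \<beta> where [simp]: "A = exp \<alpha>" "e = exp \<beta>"
    using assms by (metis exp_ln)
  have s: "sqrt (exp z) = exp (z / 2)" for z :: real
    by (simp add: powr_def flip: powr_half_sqrt)
  have p: "exp \<beta> ^ (j + 1) = exp (real (j + 1) * \<beta>)" by (rule exp_of_nat_mult[symmetric])
  have 1: "A powr (q - real j) / e ^ (j + 1) * sqrt (e / A powr (1 + 2 * q)) = (A * e) powr (- (real j + 1/2))"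
    unfolding \<open>A = exp \<alpha>\<close> \<open>e = exp \<beta>\<close> p
    by (simp add: powr_def s ln_mult flip: exp_add exp_diff) (simp add: field_simps)
  have 2: "A powr (q - real j) / e ^ (j + 1) * (e * A powr (- q)) = (A * e) powr (- real j)"
    unfolding \<open>A = exp \<alpha>\<close> \<open>e = exp \<beta>\<close> p
    by (simp add: powr_def ln_mult flip: exp_add exp_diff) (simp add: field_simps)
  show ?thesis unfolding distrib_left 1 2 ..
qed

lemma rate_a_pos: "0 < n \<Longrightarrow> 0 < rate_a q n"
  by (simp add: rate_a_def)

lemma rate_a_powr: "rate_a q n powr (1 + 2 * real q) = real n"
  by (simp add: rate_a_def powr_powr)

lemma rate_r_eq: "rate_r q n = rate_a q n powr real q"
  by (simp add: rate_a_def rate_r_def powr_powr)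

text \<open>The slope \<open>t\<close> is written as \<open>t0 + (t - t0)\<close>. The part with
  \<open>t0\<close> is the increment inside \<open>G_hat\<close>; in the other part the increment of
  \<Phi> is that of \<open>\<Phi>0\<close> plus \<open>\<eta>\<close> times
  \<open>R_hat\<close>.\<close>

lemma G_hat_R_hat_decomposition:
  assumes "0 < n" "0 < \<eta>"
  shows "Upsilon \<Gamma> \<Phi> t (x + v * \<eta>) - Upsilon \<Gamma> \<Phi> t x
      - (Upsilon \<Gamma>0 \<Phi>0 t0 (x + v * \<eta>) - Upsilon \<Gamma>0 \<Phi>0 t0 x)
    = sqrt (\<eta> / real n) * G_hat \<Gamma> \<Phi> \<Gamma>0 \<Phi>0 t0 x n v \<eta>
      - (t - t0) * (\<eta> * R_hat \<Phi> \<Phi>0 x v \<eta> + (\<Phi>0 (x + v * \<eta>) - \<Phi>0 x))"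
proof -
  have "sqrt (\<eta> / real n) * sqrt (real n / \<eta>) = 1"
    using assms by (simp flip: real_sqrt_mult)
  then have "sqrt (\<eta> / real n) * G_hat \<Gamma> \<Phi> \<Gamma>0 \<Phi>0 t0 x n v \<eta>
    = diff_incr \<Gamma> \<Gamma>0 x (v * \<eta>) - t0 * diff_incr \<Phi> \<Phi>0 x (v * \<eta>)"
    unfolding G_hat_def right_diff_distrib by (metis mult.assoc mult.left_commute mult_1)
  moreover have "\<eta> * R_hat \<Phi> \<Phi>0 x v \<eta> = diff_incr \<Phi> \<Phi>0 x (v * \<eta>)"
    using assms by (simp add: R_hat_def)
  ultimately show ?thesis unfolding distrib_left right_diff_distrib
    by (simp only:) (simp add: Upsilon_def diff_incr_def algebra_simps)
qed

section \<open>Bias and noise of the coefficient estimators\<close>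

text \<open>The slope estimator enters as a random variable with a given rate, and \<open>p\<close>
  is the number of coefficients removed by the weights. Assumption D in direction \<open>-1\<close>
  is what negative nodes call for, as they take increments to the left of \<open>x\<close>.\<close>

locale bias_reduction =
  fixes M :: "nat \<Rightarrow> 'w measure" and I :: "real set" and x s :: real
    and \<theta> \<Phi> :: "real \<Rightarrow> real" and \<Gamma>h \<Phi>h :: "nat \<Rightarrow> 'w \<Rightarrow> real \<Rightarrow> real" and \<theta>h :: "nat \<Rightarrow> 'w \<Rightarrow> real"
    and q p :: nat and c :: "nat \<Rightarrow> real" and lam :: "nat \<Rightarrow> nat \<Rightarrow> real" and \<epsilon> :: "nat \<Rightarrow> real"
  assumes prob: "\<And>n. prob_space (M n)"
    and x_interior: "x \<in> interior I"
    and q: "first_nonzero_deriv \<theta> x q"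
    and \<Gamma>h_meas: "\<And>n y. y \<in> I \<Longrightarrow> (\<lambda>\<omega>. \<Gamma>h n \<omega> y) \<in> borel_measurable (M n)"
    and \<Phi>h_meas: "\<And>n y. y \<in> I \<Longrightarrow> (\<lambda>\<omega>. \<Phi>h n \<omega> y) \<in> borel_measurable (M n)"
    and \<theta>h_meas: "\<And>n. \<theta>h n \<in> borel_measurable (M n)"
    and A: "assumption_A I x \<theta> \<Phi> q s"
    and D: "assumption_D M \<Gamma>h \<Phi>h (Gamma0 I \<theta> \<Phi>) \<Phi> \<theta> x q 1"
    and D_left: "\<exists>k\<in>{1..p+1}. c k < 0 \<Longrightarrow> assumption_D M \<Gamma>h \<Phi>h (Gamma0 I \<theta> \<Phi>) \<Phi> \<theta> x q (-1)"
    and \<theta>h_rate: "big_OP M (\<lambda>n \<omega>. rate_r q n * (\<theta>h n \<omega> - \<theta> x)) (\<lambda>_. 1)"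
    and \<epsilon>: "\<And>n. \<epsilon> n > 0" "\<epsilon> \<longlonglongrightarrow> 0"
    and p: "q \<le> p" "real p < s"
    and lam: "BR_weights p c lam"
begin

abbreviation "a \<equiv> rate_a q"
abbreviation "Dc \<equiv> D_coef \<theta> \<Phi> x q"
abbreviation "\<Upsilon>0 \<equiv> Upsilon (Gamma0 I \<theta> \<Phi>) \<Phi> (\<theta> x)"
abbreviation "\<Upsilon>h n \<omega> \<equiv> Upsilon (\<Gamma>h n \<omega>) (\<Phi>h n \<omega>) (\<theta>h n \<omega>)"
abbreviation "DBR j n \<omega> \<equiv> D_BR p c lam (\<Upsilon>h n \<omega>) x (\<epsilon> n) j"
abbreviation "\<kappa> \<equiv> min (real p + 1) s"
abbreviation "noise k n \<omega> \<equiv> \<Upsilon>h n \<omega> (x + c k * \<epsilon> n) - \<Upsilon>h n \<omega> x - (\<Upsilon>0 (x + c k * \<epsilon> n) - \<Upsilon>0 x)"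

lemma finite_M: "finite_measure (M n)"
  using prob by (simp add: prob_space.axioms)

lemma q_pos: "1 \<le> q"
  using q by (simp add: first_nonzero_deriv_def)

lemma x_in_I: "x \<in> I"
  using x_interior interior_subset by blast

lemma eventually_small:
  assumes "0 < \<delta>"
  shows "\<forall>\<^sub>F n in sequentially. \<bar>v * \<epsilon> n\<bar> < \<delta>"
proof -
  have "(\<lambda>n. v * \<epsilon> n) \<longlonglongrightarrow> 0" using \<epsilon>(2) by (rule tendsto_mult_right_zero)
  then show ?thesis using assms by (auto simp: tendsto_iff dist_real_def)
qed

lemma eventually_in_I: "\<forall>\<^sub>F n in sequentially. x + v * \<epsilon> n \<in> I"
proof -
  have "(\<lambda>n. x + v * \<epsilon> n) \<longlonglongrightarrow> x" using \<epsilon>(2) by (auto intro!: tendsto_eq_intros)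
  then have "\<forall>\<^sub>F n in sequentially. x + v * \<epsilon> n \<in> interior I"
    using x_interior by (intro topological_tendstoD) auto
  then show ?thesis by (rule eventually_mono) (use interior_subset in blast)
qed

lemma \<theta>h_bounded: "bounded_in_prob M (\<lambda>n \<omega>. \<theta>h n \<omega> - \<theta> x) (\<lambda>n. a n powr (- real q))"
proof -
  have "bounded_in_prob M (\<lambda>n \<omega>. rate_r q n * (\<theta>h n \<omega> - \<theta> x)) (\<lambda>_. 1)"
    using \<theta>h_meas
    by (intro big_OP_imp_bounded_in_prob[OF \<theta>h_rate] always_eventually allI borel_measurable_times
      borel_measurable_diff borel_measurable_const)
  from bounded_in_prob_cmult[OF this, of "\<lambda>n. a n powr (- real q)"]
  have "bounded_in_prob M (\<lambda>n \<omega>. a n powr (- real q) * (rate_r q n * (\<theta>h n \<omega> - \<theta> x))) (\<lambda>n. a n powr (- real q))"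
    by simp
  then show ?thesis
  proof (rule bounded_in_prob_cong)
    show "\<forall>\<^sub>F n in sequentially. \<forall>\<omega>\<in>space (M n). a n powr (- real q) * (rate_r q n * (\<theta>h n \<omega> - \<theta> x)) = \<theta>h n \<omega> - \<theta> x"
      using eventually_gt_at_top[of 0]
    proof eventually_elim
      case (elim n)
      have "a n powr real q \<noteq> 0" using rate_a_pos[OF elim, of q] by simp
      then show ?case by (simp add: rate_r_eq powr_minus field_simps)
    qed
  qed
qed

text \<open>The \<open>G_hat\<close> part has order \<open>sqrt (\<epsilon> n / n)\<close>. The
  other part is the slope error, of order \<open>a n powr (- q)\<close>, times an increment of order
  \<open>\<epsilon> n\<close>.\<close>

lemma noise_bounded:
  assumes k: "k \<in> {1..p+1}" and a\<epsilon>: "(\<lambda>n. 1 / (a n * \<epsilon> n)) \<in> O(\<lambda>_. 1)"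
  shows "bounded_in_prob M (noise k) (\<lambda>n. sqrt (\<epsilon> n / real n) + \<epsilon> n * a n powr (- real q))"
    (is "bounded_in_prob M _ ?w")
\<comment> \<open>A zero node gives a zero increment, while the bandwidth in Assumption D has to be
  positive.\<close>
proof (cases "c k = 0")
  case True
  then show ?thesis
    using bounded_in_prob_rate[OF bounded_in_prob_det[of M "\<lambda>_. 0"], of 0 ?w] by simp
next
  case False
  \<comment> \<open>Assumption D covers the directions \<open>1\<close> and \<open>-1\<close>; the
    size of the node is moved into the bandwidth.\<close>
  define v where "v = sgn (c k)"
  define \<eta> where "\<eta> n = \<bar>c k\<bar> * \<epsilon> n" for n
  have v\<eta>: "v * \<eta> n = c k * \<epsilon> n" for n by (simp add: v_def \<eta>_def sgn_if)
  have \<eta>: "0 < \<eta> n" for n using False \<epsilon>(1) by (simp add: \<eta>_def)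
  have w: "sqrt (\<epsilon> n / real n) \<le> ?w n" "\<epsilon> n * a n powr (- real q) \<le> ?w n" "0 \<le> ?w n" for n
    using less_imp_le[OF \<epsilon>(1), of n] by auto
  have "assumption_D M \<Gamma>h \<Phi>h (Gamma0 I \<theta> \<Phi>) \<Phi> \<theta> x q v"
  proof (cases "c k < 0")
    case True
    then have "\<exists>k\<in>{1..p+1}. c k < 0" using k by blast
    from D_left[OF this] show ?thesis using True by (simp add: v_def)
  qed (use D False in \<open>simp add: v_def\<close>)
  moreover have "\<eta> \<in> o(\<lambda>_. 1)"
    using \<epsilon>(2) by (auto simp: \<eta>_def[abs_def] intro!: smalloI_tendsto tendsto_eq_intros)
  moreover have "(\<lambda>n. 1 / (a n * \<eta> n)) \<in> O(\<lambda>_. 1)"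
  proof -
    have "(\<lambda>n. 1 / (a n * \<eta> n)) = (\<lambda>n. (1 / \<bar>c k\<bar>) * (1 / (a n * \<epsilon> n)))"
      by (auto simp: \<eta>_def)
    also have "\<dots> \<in> O(\<lambda>_. 1)" using a\<epsilon> False by (subst landau_o.big.cmult_in_iff) auto
    finally show ?thesis .
  qed
  ultimately have GR: "big_OP M (\<lambda>n \<omega>. G_hat (\<Gamma>h n \<omega>) (\<Phi>h n \<omega>) (Gamma0 I \<theta> \<Phi>) \<Phi> (\<theta> x) x n v (\<eta> n)) (\<lambda>_. 1)"
      (is "big_OP M ?G _")
    and RR: "big_OP M (\<lambda>n \<omega>. R_hat (\<Phi>h n \<omega>) \<Phi> x v (\<eta> n)) (\<lambda>_. 1)" (is "big_OP M ?R _")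
    using \<eta> unfolding assumption_D_def by auto
  have in_I: "\<forall>\<^sub>F n in sequentially. x + v * \<eta> n \<in> I"
    unfolding v\<eta> by (rule eventually_in_I)
  have "\<forall>\<^sub>F n in sequentially. ?G n \<in> borel_measurable (M n)"
    using in_I
  proof eventually_elim
    case (elim n)
    note [measurable] = \<Gamma>h_meas[OF elim] \<Gamma>h_meas[OF x_in_I] \<Phi>h_meas[OF elim] \<Phi>h_meas[OF x_in_I]
    show ?case unfolding G_hat_def diff_incr_def by measurable
  qed
  then have G: "bounded_in_prob M ?G (\<lambda>_. 1)" by (rule big_OP_imp_bounded_in_prob[OF GR])
  have "\<forall>\<^sub>F n in sequentially. ?R n \<in> borel_measurable (M n)"
    using in_I
  proof eventually_elim
    case (elim n)
    note [measurable] = \<Phi>h_meas[OF elim] \<Phi>h_meas[OF x_in_I]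
    show ?case unfolding R_hat_def diff_incr_def by measurable
  qed
  then have R: "bounded_in_prob M ?R (\<lambda>_. 1)" by (rule big_OP_imp_bounded_in_prob[OF RR])
  have T1: "bounded_in_prob M (\<lambda>n \<omega>. sqrt (\<eta> n / real n) * ?G n \<omega>) ?w"
  proof (rule bounded_in_prob_rate[OF bounded_in_prob_cmult[OF G], of _ "sqrt \<bar>c k\<bar>"], rule always_eventually, rule allI)
    fix n
    have "\<bar>sqrt (\<eta> n / real n) * 1\<bar> = sqrt \<bar>c k\<bar> * sqrt (\<epsilon> n / real n)"
      using \<epsilon>(1)[of n] by (simp add: \<eta>_def real_sqrt_mult real_sqrt_divide)
    also have "\<dots> \<le> sqrt \<bar>c k\<bar> * \<bar>?w n\<bar>" using w[of n] by (intro mult_left_mono) auto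
    finally show "\<bar>sqrt (\<eta> n / real n) * 1\<bar> \<le> sqrt \<bar>c k\<bar> * \<bar>?w n\<bar>" .
  qed
  have T2: "bounded_in_prob M (\<lambda>n \<omega>. \<eta> n * ?R n \<omega>) \<epsilon>"
    by (rule bounded_in_prob_rate[OF bounded_in_prob_cmult[OF R], of _ "\<bar>c k\<bar>"])
      (simp add: \<eta>_def abs_mult)
  obtain \<delta> C L where L: "0 < \<delta>"
    "\<forall>h. \<bar>h\<bar> < \<delta> \<longrightarrow> \<bar>\<Upsilon>0 (x + h) - \<Upsilon>0 x - (\<Sum>j=1..p. Dc j * h ^ (j + 1))\<bar> \<le> C * \<bar>h\<bar> powr (\<kappa> + 1)"
    "\<forall>h. \<bar>h\<bar> < \<delta> \<longrightarrow> \<bar>\<Phi> (x + h) - \<Phi> x\<bar> \<le> L * \<bar>h\<bar>"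
    by (rule Upsilon0_expansion[OF A q p])
  have "\<forall>\<^sub>F n in sequentially. \<bar>\<Phi> (x + v * \<eta> n) - \<Phi> x\<bar> \<le> (L * \<bar>c k\<bar>) * \<bar>\<epsilon> n\<bar>"
    using eventually_small[OF L(1), of "c k"]
  proof eventually_elim
    case (elim n)
    with L(3) have "\<bar>\<Phi> (x + c k * \<epsilon> n) - \<Phi> x\<bar> \<le> L * \<bar>c k * \<epsilon> n\<bar>" by blast
    then show ?case unfolding v\<eta> by (simp add: abs_mult mult.assoc)
  qed
  then have T3: "bounded_in_prob M (\<lambda>n \<omega>. \<Phi> (x + v * \<eta> n) - \<Phi> x) \<epsilon>"
    by (rule bounded_in_prob_rate[OF bounded_in_prob_det])
  have "bounded_in_prob M (\<lambda>n \<omega>. (\<theta>h n \<omega> - \<theta> x) * (\<eta> n * ?R n \<omega> + (\<Phi> (x + v * \<eta> n) - \<Phi> x)))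
    (\<lambda>n. a n powr (- real q) * \<epsilon> n)"
    by (intro bounded_in_prob_mult bounded_in_prob_add T2 T3 \<theta>h_bounded finite_M)
  then have "bounded_in_prob M (\<lambda>n \<omega>. (\<theta>h n \<omega> - \<theta> x) * (\<eta> n * ?R n \<omega> + (\<Phi> (x + v * \<eta> n) - \<Phi> x))) ?w"
    by (rule bounded_in_prob_rate[where C = 1])
      (use w less_imp_le[OF \<epsilon>(1)] in \<open>auto simp: abs_mult mult.commute\<close>)
  from bounded_in_prob_add[OF finite_M T1 bounded_in_prob_minus[OF this]]
  have "bounded_in_prob M (\<lambda>n \<omega>. sqrt (\<eta> n / real n) * ?G n \<omega>
      + - ((\<theta>h n \<omega> - \<theta> x) * (\<eta> n * ?R n \<omega> + (\<Phi> (x + v * \<eta> n) - \<Phi> x)))) ?w" .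
  then show ?thesis
  proof (rule bounded_in_prob_cong)
    show "\<forall>\<^sub>F n in sequentially. \<forall>\<omega>\<in>space (M n). sqrt (\<eta> n / real n) * ?G n \<omega>
      + - ((\<theta>h n \<omega> - \<theta> x) * (\<eta> n * ?R n \<omega> + (\<Phi> (x + v * \<eta> n) - \<Phi> x))) = noise k n \<omega>"
      using eventually_gt_at_top[of 0]
    proof (eventually_elim, intro ballI)
      fix n :: nat and \<omega> assume n: "0 < n"
      show "sqrt (\<eta> n / real n) * ?G n \<omega>
      + - ((\<theta>h n \<omega> - \<theta> x) * (\<eta> n * ?R n \<omega> + (\<Phi> (x + v * \<eta> n) - \<Phi> x))) = noise k n \<omega>"
        using G_hat_R_hat_decomposition[OF n \<eta>, of "\<Gamma>h n \<omega>" "\<Phi>h n \<omega>" "\<theta>h n \<omega>" x v n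
           "Gamma0 I \<theta> \<Phi>" \<Phi> "\<theta> x"]
        unfolding v\<eta> by simp
    qed
  qed
qed

text \<open>The deterministic error left when the weights act on the exact
  \<open>\<Upsilon>0\<close>.\<close>

definition bias :: "nat \<Rightarrow> nat \<Rightarrow> real" where
  "bias j n = 1 / \<epsilon> n ^ (j + 1) * (\<Sum>k=1..p+1. lam j k * (\<Upsilon>0 (x + c k * \<epsilon> n) - \<Upsilon>0 x)) - Dc j"

text \<open>The weights extract \<open>Dc j\<close> exactly from the polynomial part. The remainders
  have order \<open>\<epsilon> n powr (\<kappa> + 1)\<close>, and division by
  \<open>\<epsilon> n ^ (j + 1)\<close> leaves the exponent \<open>\<kappa> - j\<close>.\<close>

lemma bias_bound:
  assumes j: "j \<in> {1..p}"
  obtains C where "\<forall>\<^sub>F n in sequentially. \<bar>bias j n\<bar> \<le> C * \<epsilon> n powr (\<kappa> - real j)"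
proof -
  obtain \<delta> C L where C: "0 < \<delta>"
    "\<forall>h. \<bar>h\<bar> < \<delta> \<longrightarrow> \<bar>\<Upsilon>0 (x + h) - \<Upsilon>0 x - (\<Sum>j=1..p. Dc j * h ^ (j + 1))\<bar> \<le> C * \<bar>h\<bar> powr (\<kappa> + 1)"
    "\<forall>h. \<bar>h\<bar> < \<delta> \<longrightarrow> \<bar>\<Phi> (x + h) - \<Phi> x\<bar> \<le> L * \<bar>h\<bar>"
    by (rule Upsilon0_expansion[OF A q p])
  define rem where "rem h = \<Upsilon>0 (x + h) - \<Upsilon>0 x - (\<Sum>i=1..p. Dc i * h ^ (i + 1))" for h
  define C' where "C' = (\<Sum>k=1..p+1. \<bar>lam j k\<bar> * (C * \<bar>c k\<bar> powr (\<kappa> + 1)))"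
  have "(\<Sum>k=1..p+1. lam j k * (\<Sum>i=1..p. Dc i * (c k * e) ^ (i + 1))) = Dc j * e ^ (j + 1)" for e
  proof -
    have "(\<Sum>k=1..p+1. lam j k * (\<Sum>i=1..p. Dc i * (c k * e) ^ (i + 1)))
      = (\<Sum>i=1..p. Dc i * e ^ (i + 1) * (\<Sum>k=1..p+1. lam j k * c k ^ (i + 1)))"
      unfolding sum_distrib_left by (subst sum.swap) (simp add: power_mult_distrib mult_ac)
    also have "\<dots> = (\<Sum>i=1..p. Dc i * e ^ (i + 1) * (if i = j then 1 else 0))"
    proof (intro sum.cong refl)
      fix i assume "i \<in> {1..p}"
      \<comment> \<open>\<open>Dc i\<close> sits at the power \<open>i + 1\<close>, hence the shift
        between coefficient index and moment index.\<close>
      then have "i + 1 \<in> {1..p+1}" by simp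
      then have "(\<Sum>k=1..p+1. lam j k * c k ^ (i + 1)) = (if i + 1 = j + 1 then 1 else 0)"
        using lam j unfolding BR_weights_def by blast
      then show "Dc i * e ^ (i + 1) * (\<Sum>k=1..p+1. lam j k * c k ^ (i + 1)) = Dc i * e ^ (i + 1) * (if i = j then 1 else 0)"
        by simp
    qed
    also have "\<dots> = Dc j * e ^ (j + 1)" using j by (simp add: if_distrib cong: if_cong)
    finally show ?thesis .
  qed
  then have sum: "(\<Sum>k=1..p+1. lam j k * (\<Upsilon>0 (x + c k * e) - \<Upsilon>0 x))
    = (\<Sum>k=1..p+1. lam j k * rem (c k * e)) + Dc j * e ^ (j + 1)" for e
    by (simp add: rem_def right_diff_distrib sum_subtractf)
  have bias: "bias j n = 1 / \<epsilon> n ^ (j + 1) * (\<Sum>k=1..p+1. lam j k * rem (c k * \<epsilon> n))" for n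
    unfolding bias_def sum using \<epsilon>(1)[of n] by (simp add: distrib_left)
  have "\<forall>\<^sub>F n in sequentially. \<forall>k\<in>{1..p+1}. \<bar>c k * \<epsilon> n\<bar> < \<delta>"
    using eventually_small[OF C(1)] by (intro eventually_ball_finite) auto
  then have "\<forall>\<^sub>F n in sequentially. \<bar>bias j n\<bar> \<le> C' * \<epsilon> n powr (\<kappa> - real j)"
  proof eventually_elim
    case (elim n)
    have e: "0 < \<epsilon> n" by (rule \<epsilon>)
    have "\<bar>\<Sum>k=1..p+1. lam j k * rem (c k * \<epsilon> n)\<bar> \<le> (\<Sum>k=1..p+1. \<bar>lam j k\<bar> * (C * \<bar>c k\<bar> powr (\<kappa> + 1)) * \<epsilon> n powr (\<kappa> + 1))"
    proof (rule order_trans[OF sum_abs], rule sum_mono)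
      fix k assume "k \<in> {1..p+1}"
      then have "\<bar>rem (c k * \<epsilon> n)\<bar> \<le> C * \<bar>c k * \<epsilon> n\<bar> powr (\<kappa> + 1)"
        unfolding rem_def using elim C(2) by blast
      also have "\<bar>c k * \<epsilon> n\<bar> powr (\<kappa> + 1) = \<bar>c k\<bar> powr (\<kappa> + 1) * \<epsilon> n powr (\<kappa> + 1)"
        using e by (simp add: abs_mult powr_mult)
      finally have "\<bar>lam j k\<bar> * \<bar>rem (c k * \<epsilon> n)\<bar> \<le> \<bar>lam j k\<bar> * (C * (\<bar>c k\<bar> powr (\<kappa> + 1) * \<epsilon> n powr (\<kappa> + 1)))"
        by (intro mult_left_mono) auto
      then show "\<bar>lam j k * rem (c k * \<epsilon> n)\<bar> \<le> \<bar>lam j k\<bar> * (C * \<bar>c k\<bar> powr (\<kappa> + 1)) * \<epsilon> n powr (\<kappa> + 1)"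
        by (simp only: abs_mult mult.assoc)
    qed
    also have "\<dots> = C' * \<epsilon> n powr (\<kappa> + 1)" by (simp only: C'_def sum_distrib_right)
    finally have "\<bar>bias j n\<bar> \<le> 1 / \<epsilon> n ^ (j + 1) * (C' * \<epsilon> n powr (\<kappa> + 1))"
      unfolding bias abs_mult using e by (intro mult_mono) auto
    also have "\<dots> = C' * \<epsilon> n powr (\<kappa> - real j)"
    proof -
      have "\<epsilon> n powr (\<kappa> + 1) = \<epsilon> n powr (\<kappa> - real j) * \<epsilon> n ^ (j + 1)"
        using e by (simp add: powr_add[symmetric] powr_realpow[symmetric] del: power_Suc)
      then show ?thesis using e by simp
    qed
    finally show ?case .
  qed
  then show thesis by (rule that)
qed

text \<open>Linearity in \<open>\<Upsilon>\<close>: removing the bias leaves the same weights acting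
  on the noise. The factor \<open>t\<close> later becomes the scaling rate.\<close>

lemma DBR_noise:
  "t * (DBR j n \<omega> - Dc j) - t * bias j n = t / \<epsilon> n ^ (j + 1) * (\<Sum>k=1..p+1. lam j k * noise k n \<omega>)"
proof -
  have "(\<Sum>k=1..p+1. lam j k * noise k n \<omega>) = (\<Sum>k=1..p+1. lam j k * (\<Upsilon>h n \<omega> (x + c k * \<epsilon> n) - \<Upsilon>h n \<omega> x))
     - (\<Sum>k=1..p+1. lam j k * (\<Upsilon>0 (x + c k * \<epsilon> n) - \<Upsilon>0 x))"
    by (simp only: right_diff_distrib[of "lam _ _" "_ - _"] sum_subtractf)
  then show ?thesis unfolding bias_def D_BR_def by (simp only: ring_distribs) simp
qed

lemma DBR_bounded:
  assumes a\<epsilon>: "(\<lambda>n. 1 / (a n * \<epsilon> n)) \<in> O(\<lambda>_. 1)"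
  shows "bounded_in_prob M (\<lambda>n \<omega>. a n powr (real q - real j) * (DBR j n \<omega> - Dc j) - a n powr (real q - real j) * bias j n)
    (\<lambda>n. (a n * \<epsilon> n) powr (- (real j + 1/2)) + (a n * \<epsilon> n) powr (- real j))"
    (is "bounded_in_prob M _ ?b")
proof -
  let ?w = "\<lambda>n. sqrt (\<epsilon> n / real n) + \<epsilon> n * a n powr (- real q)"
  let ?t = "\<lambda>n. a n powr (real q - real j) / \<epsilon> n ^ (j + 1)"
  have "bounded_in_prob M (\<lambda>n \<omega>. lam j k * noise k n \<omega>) ?w" if "k \<in> {1..p+1}" for k
    using bounded_in_prob_cmult[OF noise_bounded[OF that a\<epsilon>], of "\<lambda>_. lam j k"]
    by (rule bounded_in_prob_rate[where C = "\<bar>lam j k\<bar>"]) (simp add: abs_mult)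
  then have "bounded_in_prob M (\<lambda>n \<omega>. \<Sum>k=1..p+1. lam j k * noise k n \<omega>) ?w"
    by (intro bounded_in_prob_sum finite_M) auto
  then have "bounded_in_prob M (\<lambda>n \<omega>. ?t n * (\<Sum>k=1..p+1. lam j k * noise k n \<omega>)) (\<lambda>n. ?t n * ?w n)"
    by (rule bounded_in_prob_cmult)
  then have "bounded_in_prob M (\<lambda>n \<omega>. ?t n * (\<Sum>k=1..p+1. lam j k * noise k n \<omega>)) ?b"
  proof (rule bounded_in_prob_rate[where C = 1])
    show "\<forall>\<^sub>F n in sequentially. \<bar>?t n * ?w n\<bar> \<le> 1 * \<bar>?b n\<bar>"
      using eventually_gt_at_top[of 0]
    proof eventually_elim
      case (elim n)
      \<comment> \<open>The sample size is read as \<open>a n powr (1 + 2 * q)\<close>, the form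
        occurring in the identity of rates.\<close>
      show ?case
        using rate_identity[OF rate_a_pos[OF elim, of q] \<epsilon>(1)[of n], of "real q" j]
        unfolding rate_a_powr by simp
    qed
  qed
  then show ?thesis unfolding DBR_noise .
qed

lemma DBR_expansion:
  assumes a\<epsilon>: "(\<lambda>n. 1 / (a n * \<epsilon> n)) \<in> O(\<lambda>_. 1)" and j: "j \<in> {1..p}"
  shows "bigO_plus_OP M
          (\<lambda>n \<omega>. a n powr (real q - real j) * (DBR j n \<omega> - Dc j))
          (\<lambda>n. a n powr (real q - real j) * \<epsilon> n powr (\<kappa> - real j))
          (\<lambda>n. (a n * \<epsilon> n) powr (- (real j + 1/2)) + (a n * \<epsilon> n) powr (- real j))"
  unfolding bigO_plus_OP_def
proof (intro exI conjI)
  \<comment> \<open>This goal fixes the deterministic witness: it is the scaled bias.\<close>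
  show "big_OP M (\<lambda>n \<omega>. a n powr (real q - real j) * (DBR j n \<omega> - Dc j) - a n powr (real q - real j) * bias j n)
    (\<lambda>n. (a n * \<epsilon> n) powr (- (real j + 1/2)) + (a n * \<epsilon> n) powr (- real j))"
    by (rule bounded_in_prob_imp_big_OP[OF finite_M DBR_bounded[OF a\<epsilon>]])
  obtain C where "\<forall>\<^sub>F n in sequentially. \<bar>bias j n\<bar> \<le> C * \<epsilon> n powr (\<kappa> - real j)"
    using bias_bound[OF j] .
  then have "\<forall>\<^sub>F n in sequentially. norm (a n powr (real q - real j) * bias j n)
     \<le> C * norm (a n powr (real q - real j) * \<epsilon> n powr (\<kappa> - real j))"
  proof eventually_elim
    case (elim n)
    have "a n powr (real q - real j) * \<bar>bias j n\<bar> \<le> a n powr (real q - real j) * (C * \<epsilon> n powr (\<kappa> - real j))"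
      using elim by (intro mult_left_mono) auto
    then show ?case by (simp add: abs_mult mult_ac)
  qed
  then show "(\<lambda>n. a n powr (real q - real j) * bias j n) \<in> O(\<lambda>n. a n powr (real q - real j) * \<epsilon> n powr (\<kappa> - real j))"
    by (rule bigoI)
qed

section \<open>Conditions on the tuning parameter\<close>

text \<open>Once \<open>\<epsilon> n < 1\<close>, replacing \<open>qb\<close> by the smaller
  \<open>q\<close> only enlarges \<open>n * \<epsilon> n powr (1 + 2 * qb)\<close>, and the root of
  order \<open>1 + 2 * q\<close> of the result is \<open>a n * \<epsilon> n\<close>.\<close>

lemma inverse_a_\<epsilon>_null:
  assumes qb: "q \<le> qb" and lim: "filterlim (\<lambda>n. real n * \<epsilon> n powr (1 + 2 * real qb)) at_top sequentially"
  shows "(\<lambda>n. 1 / (a n * \<epsilon> n)) \<longlonglongrightarrow> 0"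
proof (rule Lim_null_comparison)
  let ?g = "\<lambda>n. real n * \<epsilon> n powr (1 + 2 * real qb)"
  show "(\<lambda>n. ?g n powr (- (1 / (1 + 2 * real q)))) \<longlonglongrightarrow> 0"
    by (rule tendsto_neg_powr[OF _ lim]) simp
  have "\<forall>\<^sub>F n in sequentially. \<epsilon> n < 1" using \<epsilon>(2) by (rule order_tendstoD) simp
  then show "\<forall>\<^sub>F n in sequentially. norm (1 / (a n * \<epsilon> n)) \<le> ?g n powr (- (1 / (1 + 2 * real q)))"
    using eventually_gt_at_top[of 0]
  proof eventually_elim
    case (elim n)
    note e = \<epsilon>(1)[of n]
    have "?g n \<le> real n * \<epsilon> n powr (1 + 2 * real q)"
      using e elim qb by (intro mult_left_mono powr_mono') auto
    then have "?g n powr (1 / (1 + 2 * real q)) \<le> (real n * \<epsilon> n powr (1 + 2 * real q)) powr (1 / (1 + 2 * real q))"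
      using e by (intro powr_mono2) auto
    also have "\<dots> = a n * \<epsilon> n"
      using e by (simp add: powr_mult powr_powr rate_a_def)
    finally have "?g n powr (1 / (1 + 2 * real q)) \<le> a n * \<epsilon> n" .
    moreover have "0 < ?g n powr (1 / (1 + 2 * real q))" using e elim by simp
    ultimately have "1 / (a n * \<epsilon> n) \<le> 1 / ?g n powr (1 / (1 + 2 * real q))"
      by (intro frac_le) simp_all
    moreover have "0 < a n * \<epsilon> n" using e rate_a_pos[OF elim(2), of q] by simp
    ultimately show ?case by (simp add: powr_minus inverse_eq_divide)
  qed
qed

text \<open>For \<open>j < q\<close> the power is split as
  \<open>a^(q-j) \<epsilon>^(\<kappa>-j) = a^(q-1) \<epsilon>^(\<kappa>-1) (a \<epsilon>)^(1-j)\<close>; the first condition on the tuning parameter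
  controls the leading factor since \<open>(1+2q)/(q-1)\<close> decreases in \<open>q\<close>.\<close>

lemma bias_rate_null:
  assumes qb: "q \<le> qb" "qb \<le> p" and j: "j \<in> {1..qb}"
    and lim: "(\<lambda>n. 1 / (a n * \<epsilon> n)) \<longlonglongrightarrow> 0"
    and lim1: "qb \<noteq> 1 \<Longrightarrow> (\<lambda>n. real n * \<epsilon> n powr ((1 + 2 * real qb) * min (real p) (s - 1) / (real qb - 1))) \<longlonglongrightarrow> 0"
  shows "(\<lambda>n. a n powr (real q - real j) * \<epsilon> n powr (\<kappa> - real j)) \<longlonglongrightarrow> 0"
proof (cases "q \<le> j")
  case True
  \<comment> \<open>Both \<open>p + 1\<close> and \<open>s\<close> exceed \<open>j\<close>; the
    power of \<open>\<epsilon> n\<close> alone tends to \<open>0\<close>, as the factor in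
    \<open>a n\<close> is at most \<open>1\<close> for \<open>j \<ge> q\<close>.\<close>
  have \<kappa>j: "0 < \<kappa> - real j" using j qb p by auto
  show ?thesis
  proof (rule Lim_null_comparison)
    show "(\<lambda>n. \<epsilon> n powr (\<kappa> - real j)) \<longlonglongrightarrow> 0"
      using \<epsilon>(2) by (rule tendsto_zero_powrI[OF _ tendsto_const]) (use \<epsilon>(1) \<kappa>j in \<open>auto simp: less_imp_le\<close>)
    show "\<forall>\<^sub>F n in sequentially. norm (a n powr (real q - real j) * \<epsilon> n powr (\<kappa> - real j)) \<le> \<epsilon> n powr (\<kappa> - real j)"
      using eventually_ge_at_top[of 1]
    proof eventually_elim
      case (elim n)
      have "1 \<le> a n" using elim by (simp add: rate_a_def ge_one_powr_ge_zero)
      then have "a n powr (real q - real j) \<le> a n powr 0" using True by (intro powr_mono) auto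
      then have "a n powr (real q - real j) \<le> 1" using \<open>1 \<le> a n\<close> by simp
      then show ?case by (simp add: abs_mult mult_left_le_one_le)
    qed
  qed
next
  case False
  define \<kappa>' where "\<kappa>' = min (real p) (s - 1)"
  \<comment> \<open>Chosen so that \<open>a n powr (q - 1)\<close> is \<open>n powr (1 / u)\<close>;
    \<open>u'\<close> is the same ratio at \<open>qb\<close>, as it occurs in the
    hypothesis.\<close>
  define u where "u = (1 + 2 * real q) / (real q - 1)"
  define u' where "u' = (1 + 2 * real qb) / (real qb - 1)"
  \<comment> \<open>From \<open>1 \<le> j < q\<close>; hence both denominators are positive.\<close>
  have q2: "1 < q" "1 < qb" using False j qb by auto
  have \<kappa>': "0 \<le> \<kappa>'" "\<kappa> = \<kappa>' + 1" using p q_pos by (auto simp: \<kappa>'_def)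
  have u: "0 < u" "u' \<le> u"
    using q2 qb by (auto simp: u_def u'_def divide_simps algebra_simps)
  have "(\<lambda>n. real n * \<epsilon> n powr (u' * \<kappa>')) \<longlonglongrightarrow> 0"
    using lim1 q2 by (simp add: u'_def \<kappa>'_def)
  then have g: "(\<lambda>n. (real n * \<epsilon> n powr (u' * \<kappa>')) powr (1 / u)) \<longlonglongrightarrow> 0"
    by (rule tendsto_zero_powrI[OF _ tendsto_const]) (use u in auto)
  show ?thesis
  proof (rule Lim_null_comparison[OF _ g])
    have "\<forall>\<^sub>F n in sequentially. \<epsilon> n < 1" using \<epsilon>(2) by (rule order_tendstoD) simp
    moreover have "\<forall>\<^sub>F n in sequentially. 1 / (a n * \<epsilon> n) < 1" using lim by (rule order_tendstoD) simp
    ultimately show "\<forall>\<^sub>F n in sequentially. norm (a n powr (real q - real j) * \<epsilon> n powr (\<kappa> - real j))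
        \<le> (real n * \<epsilon> n powr (u' * \<kappa>')) powr (1 / u)"
      using eventually_gt_at_top[of 0]
    proof eventually_elim
      case (elim n)
      have e: "0 < \<epsilon> n" "0 < a n" using \<epsilon>(1) rate_a_pos[OF elim(3), of q] by auto
      then have ae: "1 \<le> a n * \<epsilon> n" using elim(2) by (simp add: divide_simps mult_pos_pos)
      have "a n powr (real q - real j) * \<epsilon> n powr (\<kappa> - real j)
        = (a n powr (real q - 1) * \<epsilon> n powr \<kappa>') * (a n * \<epsilon> n) powr (1 - real j)"
      proof -
        have "a n powr (real q - real j) = a n powr (real q - 1) * a n powr (1 - real j)"
          by (simp flip: powr_add)
        moreover have "\<epsilon> n powr (\<kappa> - real j) = \<epsilon> n powr \<kappa>' * \<epsilon> n powr (1 - real j)"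
          unfolding \<kappa>'(2) by (simp add: algebra_simps flip: powr_add)
        ultimately show ?thesis using e by (simp add: powr_mult)
      qed
      \<comment> \<open>The base \<open>a n * \<epsilon> n\<close> is at least \<open>1\<close> and
        the exponent \<open>1 - j\<close> is non-positive.\<close>
      also have "\<dots> \<le> (a n powr (real q - 1) * \<epsilon> n powr \<kappa>') * 1"
      proof (intro mult_left_mono)
        have "(a n * \<epsilon> n) powr (1 - real j) \<le> (a n * \<epsilon> n) powr 0"
          using ae j by (intro powr_mono) auto
        then show "(a n * \<epsilon> n) powr (1 - real j) \<le> 1" using ae e by simp
      qed auto
      also have "a n powr (real q - 1) = real n powr (1 / u)"
        by (simp add: rate_a_def powr_powr u_def)
      also have "\<epsilon> n powr \<kappa>' = (\<epsilon> n powr (u * \<kappa>')) powr (1 / u)"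
        using u by (simp add: powr_powr)
      also have "real n powr (1 / u) * (\<epsilon> n powr (u * \<kappa>')) powr (1 / u) * 1 = (real n * \<epsilon> n powr (u * \<kappa>')) powr (1 / u)"
        by (simp add: powr_mult)
      \<comment> \<open>As \<open>\<epsilon> n < 1\<close>, the smaller exponent
        \<open>u' * \<kappa>'\<close> gives the larger power.\<close>
      also have "\<dots> \<le> (real n * \<epsilon> n powr (u' * \<kappa>')) powr (1 / u)"
        using e u elim \<kappa>'(1) by (intro powr_mono2 mult_left_mono powr_mono' mult_right_mono) auto
      finally show ?case by simp
    qed
  qed
qed

text \<open>The noise vanishes because its rate consists of negative powers of
  \<open>a n * \<epsilon> n\<close>, which diverges; the bias vanishes by the first condition on the
  tuning parameter.\<close>

lemma scaled_error_null:
  assumes qb: "q \<le> qb" "qb \<le> p" and j: "j \<in> {1..qb}"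
    and lim: "(\<lambda>n. 1 / (a n * \<epsilon> n)) \<longlonglongrightarrow> 0"
    and lim1: "qb \<noteq> 1 \<Longrightarrow> (\<lambda>n. real n * \<epsilon> n powr ((1 + 2 * real qb) * min (real p) (s - 1) / (real qb - 1))) \<longlonglongrightarrow> 0"
  shows "null_in_prob M (\<lambda>n \<omega>. a n powr (real q - real j) * (DBR j n \<omega> - Dc j))"
proof -
  have a\<epsilon>: "(\<lambda>n. 1 / (a n * \<epsilon> n)) \<in> O(\<lambda>_. 1)"
    using lim by (intro bigoI_tendsto[of _ _ 0]) auto
  have pw: "(\<lambda>n. (a n * \<epsilon> n) powr (- y)) \<longlonglongrightarrow> 0" if "0 < y" for y
  proof -
    have "(\<lambda>n. (1 / (a n * \<epsilon> n)) powr y) \<longlonglongrightarrow> 0"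
      by (rule tendsto_zero_powrI[OF lim tendsto_const _ that])
        (auto simp: rate_a_def less_imp_le[OF \<epsilon>(1)])
    then show ?thesis
      by (simp add: powr_minus powr_divide inverse_eq_divide)
  qed
  have "null_in_prob M (\<lambda>n \<omega>. a n powr (real q - real j) * (DBR j n \<omega> - Dc j) - a n powr (real q - real j) * bias j n)"
  proof (rule bounded_in_prob_imp_null[OF DBR_bounded[OF a\<epsilon>]])
    show "(\<lambda>n. (a n * \<epsilon> n) powr (- (real j + 1/2)) + (a n * \<epsilon> n) powr (- real j)) \<longlonglongrightarrow> 0"
      using tendsto_add[OF pw[of "real j + 1/2"] pw[of "real j"]] j by simp
  qed
  moreover have "null_in_prob M (\<lambda>n \<omega>. a n powr (real q - real j) * bias j n)"
  proof -
    have "j \<in> {1..p}" using j qb by auto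
    then obtain C where "\<forall>\<^sub>F n in sequentially. \<bar>bias j n\<bar> \<le> C * \<epsilon> n powr (\<kappa> - real j)"
      by (rule bias_bound)
    then have *:  "\<forall>\<^sub>F n in sequentially. norm (a n powr (real q - real j) * bias j n)
      \<le> C * (a n powr (real q - real j) * \<epsilon> n powr (\<kappa> - real j))"
    proof eventually_elim
      case (elim n)
      have "a n powr (real q - real j) * \<bar>bias j n\<bar> \<le> a n powr (real q - real j) * (C * \<epsilon> n powr (\<kappa> - real j))"
        using elim by (intro mult_left_mono) auto
      then show ?case by (simp add: abs_mult mult_ac)
    qed
    have "(\<lambda>n. C * (a n powr (real q - real j) * \<epsilon> n powr (\<kappa> - real j))) \<longlonglongrightarrow> 0"
      by (rule tendsto_mult_right_zero[OF bias_rate_null[OF assms]])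
    then show ?thesis by (intro null_in_prob_det Lim_null_comparison[OF *])
  qed
  ultimately show ?thesis
    using null_in_prob_add[OF finite_M] by fastforce
qed

end

section \<open>The bias-reduced polynomial\<close>

text \<open>Only even powers with non-negative coefficients occur.\<close>

lemma M_tilde_mono_abs:
  assumes "\<bar>v\<bar> \<le> \<bar>w\<bar>"
  shows "M_tilde qb D v \<le> M_tilde qb D w"
  unfolding M_tilde_def
proof (intro sum_mono mult_left_mono)
  fix l :: nat
  have "\<bar>v\<bar> ^ (2 * l) \<le> \<bar>w\<bar> ^ (2 * l)" using assms by (intro power_mono) auto
  then show "v ^ (2 * l) \<le> w ^ (2 * l)" by (simp add: power_even_abs)
qed simp

text \<open>An odd \<open>q\<close> has the form \<open>2 * l - 1\<close>, so its term occurs in the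
  sum. All other terms are non-negative, and taking the positive part only increases this
  one.\<close>

lemma M_tilde_ge:
  assumes "odd q" "q \<le> qb"
  shows "D q * v ^ (q + 1) \<le> M_tilde qb D v"
proof -
  define l where "l = (q + 1) div 2"
  have l: "2 * l = q + 1" "l \<in> {1..(qb + 1) div 2}" using assms by (auto simp: l_def elim!: oddE)
  have "D q * v ^ (q + 1) \<le> max (D q) 0 * v ^ (q + 1)"
  proof (rule mult_right_mono)
    show "0 \<le> v ^ (q + 1)" using assms by (intro zero_le_even_power) simp
  qed simp
  also have "\<dots> = max (D (2 * l - 1)) 0 * v ^ (2 * l)" using l by simp
  also have "\<dots> \<le> M_tilde qb D v"
    unfolding M_tilde_def using l(2) by (intro member_le_sum) auto
  finally show ?thesis .
qed

text \<open>By monotonicity in \<open>|v|\<close> the infimum belongs to the boundary point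
  \<open>1 / K\<close>, which lies outside the set and is reached by continuity from the right. An
  infimum over a continuum thus becomes one random variable.\<close>

lemma M_tilde_INF:
  assumes "0 < K"
  shows "(INF v\<in>{v. \<bar>v\<bar> > 1 / K}. M_tilde qb D v) = M_tilde qb D (1 / K)"
proof (rule antisym)
  have bdd: "bdd_below (M_tilde qb D ` {v. \<bar>v\<bar> > 1 / K})"
    by (rule bdd_belowI2[of _ "M_tilde qb D (1 / K)"]) (use assms in \<open>auto intro: M_tilde_mono_abs\<close>)
  show "(INF v\<in>{v. \<bar>v\<bar> > 1 / K}. M_tilde qb D v) \<le> M_tilde qb D (1 / K)"
  proof (rule tendsto_lowerbound)
    show "(M_tilde qb D \<longlongrightarrow> M_tilde qb D (1 / K)) (at_right (1 / K))"
      unfolding M_tilde_def by (intro tendsto_intros)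
    show "\<forall>\<^sub>F v in at_right (1 / K). (INF v\<in>{v. \<bar>v\<bar> > 1 / K}. M_tilde qb D v) \<le> M_tilde qb D v"
      using eventually_at_right_less[of "1 / K"]
    proof eventually_elim
      case (elim v)
      then show ?case by (intro cINF_lower[OF bdd]) auto
    qed
  qed simp
  have "\<bar>1 / K + 1\<bar> > 1 / K" using assms by (simp add: abs_if)
  then have "{v. \<bar>v\<bar> > 1 / K} \<noteq> {}" by blast
  then show "M_tilde qb D (1 / K) \<le> (INF v\<in>{v. \<bar>v\<bar> > 1 / K}. M_tilde qb D v)"
    by (rule cINF_greatest) (use assms in \<open>auto intro: M_tilde_mono_abs\<close>)
qed

text \<open>Since \<open>n * a = a powr (2 * (q + 1))\<close>, the square root is
  \<open>a powr (q + 1)\<close>, and the coefficient of \<open>v ^ (2 * l)\<close> receives exactly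
  the scaling of the coefficient errors. A positive factor passes into the positive part.\<close>

lemma M_tilde_scaled:
  assumes "0 < n"
  shows "sqrt (real n * rate_a q n) * M_tilde qb D (v / rate_a q n)
    = (\<Sum>l=1..(qb + 1) div 2. max (rate_a q n powr (real q - real (2 * l - 1)) * D (2 * l - 1)) 0 * v ^ (2 * l))"
proof -
  let ?a = "rate_a q n"
  have a: "0 < ?a" by (rule rate_a_pos[OF assms])
  have "real n * ?a = ?a powr (1 + 2 * real q) * ?a powr 1" using a by (simp add: rate_a_powr)
  also have "\<dots> = ?a powr (1 + 2 * real q + 1)" by (rule powr_add[symmetric])
  also have "1 + 2 * real q + 1 = 2 * (real q + 1)" by simp
  finally have "sqrt (real n * ?a) = ?a powr (real q + 1)"
    by (simp add: powr_powr algebra_simps flip: powr_half_sqrt)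
  then have "sqrt (real n * ?a) * M_tilde qb D (v / ?a)
    = (\<Sum>l=1..(qb + 1) div 2. ?a powr (real q + 1) * (max (D (2 * l - 1)) 0 * (v / ?a) ^ (2 * l)))"
    by (simp add: M_tilde_def sum_distrib_left)
  also have "\<dots> = (\<Sum>l=1..(qb + 1) div 2. max (?a powr (real q - real (2 * l - 1)) * D (2 * l - 1)) 0 * v ^ (2 * l))"
  proof (intro sum.cong refl)
    fix l assume l: "l \<in> {1..(qb + 1) div 2}"
    have "real q - real (2 * l - 1) = real q + 1 - real (2 * l)"
      using l by (simp add: of_nat_diff)
    then have "?a powr (real q - real (2 * l - 1)) = ?a powr (real q + 1 - real (2 * l))"
      by (simp only:)
    also have "\<dots> = ?a powr (real q + 1) / ?a ^ (2 * l)"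
      using a by (simp only: powr_diff powr_realpow)
    finally have 1: "?a powr (real q - real (2 * l - 1)) = ?a powr (real q + 1) / ?a ^ (2 * l)" .
    have 2: "max (t * D (2 * l - 1)) 0 = t * max (D (2 * l - 1)) 0" if "0 \<le> t" for t
      using that max_mult_distrib_left[of t "D (2 * l - 1)" 0] by simp
    have "max (?a powr (real q - real (2 * l - 1)) * D (2 * l - 1)) 0
      = ?a powr (real q - real (2 * l - 1)) * max (D (2 * l - 1)) 0" by (rule 2) simp
    then show "?a powr (real q + 1) * (max (D (2 * l - 1)) 0 * (v / ?a) ^ (2 * l))
      = max (?a powr (real q - real (2 * l - 1)) * D (2 * l - 1)) 0 * v ^ (2 * l)"
      unfolding 1 by (simp add: power_divide)
  qed
  finally show ?thesis .
qed

context bias_reduction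
begin

lemma odd_q: "odd q" and Dc_q_pos: "0 < Dc q"
  using leading_coefficient[OF A q] p by auto

lemma DBR_measurable: "\<forall>\<^sub>F n in sequentially. \<forall>j. DBR j n \<in> borel_measurable (M n)"
proof -
  have "\<forall>\<^sub>F n in sequentially. \<forall>k\<in>{1..p+1}. x + c k * \<epsilon> n \<in> I"
    using eventually_in_I by (intro eventually_ball_finite) auto
  then show ?thesis
  proof eventually_elim
    case (elim n)
    have "(\<lambda>\<omega>. \<Upsilon>h n \<omega> y) \<in> borel_measurable (M n)" if "y \<in> I" for y
      unfolding Upsilon_def using \<Gamma>h_meas[OF that] \<Phi>h_meas[OF that] \<theta>h_meas
      by (intro borel_measurable_diff borel_measurable_times)
    then show ?case unfolding D_BR_def using elim x_in_I
      by (intro allI borel_measurable_times borel_measurable_sum borel_measurable_diff borel_measurable_const) auto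
  qed
qed

section \<open>Consequences of the rate conditions\<close>

context
  fixes qb :: nat
  assumes qb: "q \<le> qb" "qb \<le> p"
    and lim1: "qb \<noteq> 1 \<longrightarrow> (\<lambda>n. real n * \<epsilon> n powr ((1 + 2 * real qb) * min (real p) (s - 1) / (real qb - 1))) \<longlonglongrightarrow> 0"
    and lim2: "filterlim (\<lambda>n. real n * \<epsilon> n powr (1 + 2 * real qb)) at_top sequentially"
begin

lemma error_null:
  assumes "l \<in> {1..(qb + 1) div 2}"
  shows "null_in_prob M (\<lambda>n \<omega>. a n powr (real q - real (2 * l - 1)) * (DBR (2 * l - 1) n \<omega> - Dc (2 * l - 1)))"
proof (rule scaled_error_null[OF qb _ inverse_a_\<epsilon>_null[OF qb(1) lim2]])
  show "2 * l - 1 \<in> {1..qb}" using assms by auto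
qed (use lim1 in simp)

abbreviation "dev l n \<omega> \<equiv>
  a n powr (real q - real (2 * l - 1)) * DBR (2 * l - 1) n \<omega> - (if 2 * l - 1 = q then Dc q else 0)"

text \<open>The scaled true coefficients converge to the subtracted value: below \<open>q\<close>
  they are \<open>0\<close>, at \<open>q\<close> the scaling factor is \<open>1\<close>, and above
  \<open>q\<close> a negative power of \<open>a n\<close> removes them.\<close>

lemma dev_null:
  assumes l: "l \<in> {1..(qb + 1) div 2}"
  shows "null_in_prob M (dev l)"
proof -
  let ?j = "2 * l - 1"
  let ?b = "\<lambda>n. a n powr (real q - real ?j) * Dc ?j - (if ?j = q then Dc q else 0)"
  have "?b \<longlonglongrightarrow> 0"
  proof -
    consider "?j < q" | "?j = q" | "q < ?j" by linarith
    then show ?thesis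
    proof cases
      case 1
      then show ?thesis by (simp add: D_coef_def)
    next
      case 2
      have "\<forall>\<^sub>F n in sequentially. ?b n = 0"
        using eventually_gt_at_top[of 0]
      proof eventually_elim
        case (elim n)
        then show ?case using 2 rate_a_pos[OF elim, of q] by simp
      qed
      then show ?thesis by (rule tendsto_eventually)
    next
      case 3
      have "(\<lambda>n. real n powr ((real q - real ?j) / (1 + 2 * real q))) \<longlonglongrightarrow> 0"
        by (rule tendsto_neg_powr[OF _ filterlim_real_sequentially]) (use 3 in \<open>simp add: divide_neg_pos\<close>)
      then have "(\<lambda>n. a n powr (real q - real ?j)) \<longlonglongrightarrow> 0" by (simp add: rate_a_def powr_powr)
      then show ?thesis using 3 by (auto intro: tendsto_mult_left_zero)
    qed
  qed
  from null_in_prob_add[OF finite_M error_null[OF l] null_in_prob_det[OF this]]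
  show ?thesis by (simp add: right_diff_distrib)
qed

text \<open>Brings the limit into the form of the scaled estimator for a comparison term by term.
  Oddness of \<open>q\<close> supplies the term, and \<open>Dc q > 0\<close> makes its positive part
  harmless.\<close>

lemma M_limit_eq:
  "M_limit \<theta> \<Phi> x q v = (\<Sum>l=1..(qb + 1) div 2. max (if 2 * l - 1 = q then Dc q else 0) 0 * v ^ (2 * l))"
proof -
  define l0 where "l0 = (q + 1) div 2"
  have l0: "2 * l0 = q + 1" "l0 \<in> {1..(qb + 1) div 2}" using odd_q qb by (auto simp: l0_def elim!: oddE)
  have "(\<Sum>l=1..(qb + 1) div 2. max (if 2 * l - 1 = q then Dc q else 0) 0 * v ^ (2 * l))
    = (\<Sum>l=1..(qb + 1) div 2. if l = l0 then Dc q * v ^ (q + 1) else 0)"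
    using l0 Dc_q_pos by (intro sum.cong) auto
  then show ?thesis using l0(2) by (simp add: M_limit_def)
qed

text \<open>The positive part is Lipschitz with constant \<open>1\<close>. On a compact set with
  \<open>|v| \<le> B\<close> the distance is therefore at most the sum of \<open>B ^ (2 * l)\<close>
  times the deviations, uniformly in \<open>v\<close>.\<close>

lemma M_tilde_conv:
  "conv_ucc_in_prob M (\<lambda>n \<omega> v. sqrt (real n * a n) * M_tilde qb (\<lambda>j. DBR j n \<omega>) (v / a n)) (M_limit \<theta> \<Phi> x q)"
  unfolding conv_ucc_in_prob_def
proof (intro allI impI)
  fix C :: "real set" assume C: "compact C \<and> C \<noteq> {}"
  then obtain B where B: "\<And>v. v \<in> C \<Longrightarrow> \<bar>v\<bar> \<le> B"
    using compact_imp_bounded[of C] unfolding bounded_iff by auto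
  let ?L = "{1..(qb + 1) div 2}"
  let ?diff = "\<lambda>n \<omega> v. \<bar>sqrt (real n * a n) * M_tilde qb (\<lambda>j. DBR j n \<omega>) (v / a n) - M_limit \<theta> \<Phi> x q v\<bar>"
  have "null_in_prob M (\<lambda>n \<omega>. \<Sum>l\<in>?L. B ^ (2 * l) * \<bar>dev l n \<omega>\<bar>)"
    by (intro null_in_prob_sum finite_M null_in_prob_cmult null_in_prob_mono[OF dev_null]) auto
  then have "null_in_prob M (\<lambda>n \<omega>. SUP v\<in>C. ?diff n \<omega> v)"
  proof (rule null_in_prob_mono)
    show "\<forall>\<^sub>F n in sequentially. \<forall>\<omega>\<in>space (M n). \<bar>SUP v\<in>C. ?diff n \<omega> v\<bar> \<le> \<bar>\<Sum>l\<in>?L. B ^ (2 * l) * \<bar>dev l n \<omega>\<bar>\<bar>"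
      using eventually_gt_at_top[of 0]
    proof (eventually_elim, intro ballI)
      fix n :: nat and \<omega> assume n: "0 < n"
      have le: "?diff n \<omega> v \<le> (\<Sum>l\<in>?L. B ^ (2 * l) * \<bar>dev l n \<omega>\<bar>)" if v: "v \<in> C" for v
      proof -
        let ?u = "\<lambda>l. a n powr (real q - real (2 * l - 1)) * DBR (2 * l - 1) n \<omega>"
        let ?d = "\<lambda>l. if 2 * l - 1 = q then Dc q else 0"
        have "?diff n \<omega> v = \<bar>\<Sum>l\<in>?L. (max (?u l) 0 - max (?d l) 0) * v ^ (2 * l)\<bar>"
          unfolding M_tilde_scaled[OF n] M_limit_eq by (simp only: left_diff_distrib sum_subtractf)
        also have "\<dots> \<le> (\<Sum>l\<in>?L. \<bar>(max (?u l) 0 - max (?d l) 0) * v ^ (2 * l)\<bar>)" by (rule sum_abs)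
        also have "\<dots> \<le> (\<Sum>l\<in>?L. \<bar>dev l n \<omega>\<bar> * B ^ (2 * l))"
        proof (intro sum_mono)
          fix l
          have "\<bar>max (?u l) 0 - max (?d l) 0\<bar> \<le> \<bar>dev l n \<omega>\<bar>" by linarith
          moreover have "\<bar>v ^ (2 * l)\<bar> \<le> B ^ (2 * l)"
            unfolding power_abs using B[OF v] by (intro power_mono) auto
          ultimately show "\<bar>(max (?u l) 0 - max (?d l) 0) * v ^ (2 * l)\<bar> \<le> \<bar>dev l n \<omega>\<bar> * B ^ (2 * l)"
            unfolding abs_mult by (rule mult_mono) auto
        qed
        finally show ?thesis by (simp only: mult.commute)
      qed
      obtain v where v: "v \<in> C" using C by blast
      have "bdd_above (?diff n \<omega> ` C)" using le by (intro bdd_aboveI2)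
      then have "?diff n \<omega> v \<le> (SUP v\<in>C. ?diff n \<omega> v)" by (intro cSUP_upper v)
      then have "0 \<le> (SUP v\<in>C. ?diff n \<omega> v)" by (rule order_trans[rotated]) simp
      moreover have "(SUP v\<in>C. ?diff n \<omega> v) \<le> (\<Sum>l\<in>?L. B ^ (2 * l) * \<bar>dev l n \<omega>\<bar>)"
        using C le by (intro cSUP_least) auto
      ultimately show "\<bar>SUP v\<in>C. ?diff n \<omega> v\<bar> \<le> \<bar>\<Sum>l\<in>?L. B ^ (2 * l) * \<bar>dev l n \<omega>\<bar>\<bar>" by linarith
    qed
  qed
  then show "small_oP1 M (\<lambda>n \<omega>. SUP v\<in>C. ?diff n \<omega> v)"
    by (rule null_in_prob_imp_small_oP1[OF finite_M])
qed

text \<open>With probability tending to one the estimator of \<open>Dc q\<close> errs by at most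
  half of \<open>Dc q\<close>, so it is at least \<open>Dc q / 2\<close>; its term alone bounds the
  polynomial at \<open>1 / K\<close>.\<close>

lemma M_tilde_liminf:
  assumes K: "0 < K"
  shows "liminf (\<lambda>n. ereal (measure (M n)
    {\<omega> \<in> space (M n). (INF v\<in>{v. \<bar>v\<bar> > 1 / K}. M_tilde qb (\<lambda>j. DBR j n \<omega>) v) \<ge> (Dc q / 2) / K ^ (q + 1)})) = 1"
proof -
  define S where "S n = {\<omega> \<in> space (M n). M_tilde qb (\<lambda>j. DBR j n \<omega>) (1 / K) \<ge> (Dc q / 2) / K ^ (q + 1)}" for n
  define l0 where "l0 = (q + 1) div 2"
  have l0: "2 * l0 - 1 = q" "l0 \<in> {1..(qb + 1) div 2}" using odd_q qb by (auto simp: l0_def elim!: oddE)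
  have "(\<lambda>n. measure (M n) (S n)) \<longlonglongrightarrow> 1"
  proof (rule tendstoI)
    fix d :: real assume d: "0 < d"
    have "\<forall>\<^sub>F n in sequentially. outside_small (M n) (d / 2) (\<lambda>\<omega>. \<bar>dev l0 n \<omega>\<bar> \<le> Dc q / 2)"
      using dev_null[OF l0(2)] half_gt_zero[OF Dc_q_pos] half_gt_zero[OF d] unfolding null_in_prob_def by blast
    then show "\<forall>\<^sub>F n in sequentially. dist (measure (M n) (S n)) 1 < d"
      using DBR_measurable eventually_gt_at_top[of 0]
    proof eventually_elim
      case (elim n)
      interpret prob_space "M n" by (rule prob)
      obtain E where E: "E \<in> sets (M n)" "measure (M n) E \<le> d / 2"
        "\<forall>\<omega>\<in>space (M n) - E. \<bar>dev l0 n \<omega>\<bar> \<le> Dc q / 2"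
        using elim(1) unfolding outside_small_def by blast
      note [measurable] = elim(2)[rule_format]
      have S: "S n \<in> sets (M n)" unfolding S_def M_tilde_def by measurable
      have "space (M n) - E \<subseteq> S n"
      proof
        fix \<omega> assume \<omega>: "\<omega> \<in> space (M n) - E"
        then have "\<bar>dev l0 n \<omega>\<bar> \<le> Dc q / 2" using E(3) by blast
        \<comment> \<open>At order \<open>q\<close> the scaling factor is
          \<open>a n powr 0 = 1\<close>.\<close>
        then have "\<bar>DBR q n \<omega> - Dc q\<bar> \<le> Dc q / 2"
          using rate_a_pos[OF elim(3), of q] unfolding l0(1) by simp
        then have "Dc q / 2 \<le> DBR q n \<omega>" by linarith
        then have "(Dc q / 2) * (1 / K) ^ (q + 1) \<le> DBR q n \<omega> * (1 / K) ^ (q + 1)"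
          using K by (intro mult_right_mono) auto
        also have "\<dots> \<le> M_tilde qb (\<lambda>j. DBR j n \<omega>) (1 / K)"
          by (rule M_tilde_ge[OF odd_q qb(1)])
        finally show "\<omega> \<in> S n" using \<omega> by (simp add: S_def power_one_over field_simps)
      qed
      then have "measure (M n) (space (M n) - E) \<le> measure (M n) (S n)"
        using S by (intro finite_measure_mono)
      then have "1 - d / 2 \<le> measure (M n) (S n)" using prob_compl[OF E(1)] E(2) by simp
      then show ?case using d prob_le_1[of "S n"] by (simp add: dist_real_def)
    qed
  qed
  then have "(\<lambda>n. ereal (measure (M n) (S n))) \<longlonglongrightarrow> ereal 1" by simp
  then have "liminf (\<lambda>n. ereal (measure (M n) (S n))) = ereal 1" by (intro lim_imp_Liminf) auto
  then show ?thesis unfolding M_tilde_INF[OF K] S_def by (simp add: one_ereal_def)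
qed

end

end

section \<open>Expansion, consistency and lower bound combined\<close>

theorem lemma2:
  fixes M :: "nat \<Rightarrow> 'w measure"
    and I :: "real set" and x s :: real
    and \<theta>0 \<Phi>0 :: "real \<Rightarrow> real"
    and \<Gamma>h \<Phi>h :: "nat \<Rightarrow> 'w \<Rightarrow> real \<Rightarrow> real" and uh :: "nat \<Rightarrow> 'w \<Rightarrow> real"
    and q qb sb :: nat
    and c :: "nat \<Rightarrow> real" and lam :: "nat \<Rightarrow> nat \<Rightarrow> real" and \<epsilon> :: "nat \<Rightarrow> real"
  defines "\<Gamma>0 \<equiv> Gamma0 I \<theta>0 \<Phi>0"
    and "\<theta>h \<equiv> \<lambda>n \<omega>. theta_hat I (\<Gamma>h n \<omega>) (\<Phi>h n \<omega>) (uh n \<omega>) x"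
  defines "\<Upsilon>h \<equiv> \<lambda>n \<omega>. Upsilon (\<Gamma>h n \<omega>) (\<Phi>h n \<omega>) (\<theta>h n \<omega>)"
  defines "DBR \<equiv> \<lambda>j n \<omega>. D_BR sb c lam (\<Upsilon>h n \<omega>) x (\<epsilon> n) j"
    and "D \<equiv> D_coef \<theta>0 \<Phi>0 x q"
  defines "Mt \<equiv> \<lambda>n \<omega>. M_tilde qb (\<lambda>j. DBR j n \<omega>)"
    and "a \<equiv> rate_a q" and "r \<equiv> rate_r q"
  assumes prob: "\<And>n. prob_space (M n)"
    and x_interior: "x \<in> interior I"
    and q: "first_nonzero_deriv \<theta>0 x q"
    and \<Gamma>h_meas: "\<And>n y. y \<in> I \<Longrightarrow> (\<lambda>\<omega>. \<Gamma>h n \<omega> y) \<in> borel_measurable (M n)"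
    and \<Phi>h_meas: "\<And>n y. y \<in> I \<Longrightarrow> (\<lambda>\<omega>. \<Phi>h n \<omega> y) \<in> borel_measurable (M n)"
    and \<theta>h_meas: "\<And>n. \<theta>h n \<in> borel_measurable (M n)"
    and \<Phi>h_nonneg: "\<And>n \<omega> y. \<omega> \<in> space (M n) \<Longrightarrow> y \<in> I \<Longrightarrow> \<Phi>h n \<omega> y \<ge> 0"
    and \<Phi>h_mono: "\<And>n \<omega>. \<omega> \<in> space (M n) \<Longrightarrow> mono_on I (\<Phi>h n \<omega>)"
    and \<Phi>h_rcont: "\<And>n \<omega> y. \<omega> \<in> space (M n) \<Longrightarrow> y \<in> I \<Longrightarrow>
          (\<Phi>h n \<omega> \<longlongrightarrow> \<Phi>h n \<omega> y) (at y within (I \<inter> {y<..}))"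
    and A: "assumption_A I x \<theta>0 \<Phi>0 q s"
    and D: "assumption_D M \<Gamma>h \<Phi>h \<Gamma>0 \<Phi>0 \<theta>0 x q 1"
    and D_left: "\<exists>k\<in>{1..sb+1}. c k < 0 \<Longrightarrow> assumption_D M \<Gamma>h \<Phi>h \<Gamma>0 \<Phi>0 \<theta>0 x q (-1)"
    and \<theta>h_rate: "big_OP M (\<lambda>n \<omega>. r n * (\<theta>h n \<omega> - \<theta>0 x)) (\<lambda>_. 1)"
    and \<epsilon>: "\<And>n. \<epsilon> n > 0" "\<epsilon> \<longlonglongrightarrow> 0"
    and orders: "q \<le> qb" "qb \<le> sb" "real sb < s"
    and c: "invertible_mat (BR_matrix (sb + 1) c)"
    and lam: "BR_weights sb c lam"
  shows "((\<lambda>n. 1 / (a n * \<epsilon> n)) \<in> O(\<lambda>_. 1) \<longrightarrow>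
      (\<forall>j\<in>{1..sb}.
        bigO_plus_OP M
          (\<lambda>n \<omega>. a n powr (real q - real j) * (DBR j n \<omega> - D j))
          (\<lambda>n. a n powr (real q - real j) * \<epsilon> n powr (min (real sb + 1) s - real j))
          (\<lambda>n. (a n * \<epsilon> n) powr (- (real j + 1/2)) + (a n * \<epsilon> n) powr (- real j))))
    \<and> ((qb \<noteq> 1 \<longrightarrow>
          (\<lambda>n. real n * \<epsilon> n powr ((1 + 2 * real qb) * min (real sb) (s - 1) / (real qb - 1)))
            \<longlonglongrightarrow> 0)
        \<and> filterlim (\<lambda>n. real n * \<epsilon> n powr (1 + 2 * real qb)) at_top sequentially
      \<longrightarrow>
        (\<forall>l\<in>{1..(qb + 1) div 2}.
          small_oP1 M (\<lambda>n \<omega>. a n powr (real q - real (2*l - 1))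
                               * (DBR (2*l - 1) n \<omega> - D (2*l - 1))))
        \<and> conv_ucc_in_prob M (\<lambda>n \<omega> v. sqrt (real n * a n) * Mt n \<omega> (v / a n))
            (M_limit \<theta>0 \<Phi>0 x q)
        \<and> (\<exists>c0>0. \<forall>K>0.
            liminf (\<lambda>n. ereal (measure (M n)
              {\<omega> \<in> space (M n). (INF v\<in>{v. \<bar>v\<bar> > 1 / K}. Mt n \<omega> v) \<ge> c0 / K ^ (q + 1)})) = 1))"
proof -
  \<comment> \<open>The slope variable becomes the estimator built from the greatest convex
    minorant, and the order \<open>p\<close> becomes \<open>sb\<close>.\<close>
  interpret bias_reduction M I x s \<theta>0 \<Phi>0 \<Gamma>h \<Phi>h \<theta>h q sb c lam \<epsilon>
    by (rule bias_reduction.intro)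
      (fact prob x_interior q \<Gamma>h_meas \<Phi>h_meas \<theta>h_meas A D[unfolded \<Gamma>0_def] D_left[unfolded \<Gamma>0_def]
        \<theta>h_rate[unfolded r_def] \<epsilon> order_trans[OF orders(1,2)] orders(3) lam)+
  show ?thesis
    unfolding DBR_def D_def Mt_def a_def \<Upsilon>h_def
  proof (intro conjI impI ballI; (elim conjE)?)
    fix j assume "(\<lambda>n. 1 / (rate_a q n * \<epsilon> n)) \<in> O(\<lambda>_. 1)" "j \<in> {1..sb}"
    then show "bigO_plus_OP M
          (\<lambda>n \<omega>. rate_a q n powr (real q - real j) * (D_BR sb c lam (Upsilon (\<Gamma>h n \<omega>) (\<Phi>h n \<omega>) (\<theta>h n \<omega>)) x (\<epsilon> n) j - D_coef \<theta>0 \<Phi>0 x q j))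
          (\<lambda>n. rate_a q n powr (real q - real j) * \<epsilon> n powr (min (real sb + 1) s - real j))
          (\<lambda>n. (rate_a q n * \<epsilon> n) powr (- (real j + 1/2)) + (rate_a q n * \<epsilon> n) powr (- real j))"
      by (rule DBR_expansion)
  next
    assume lim: "qb \<noteq> 1 \<longrightarrow>
          (\<lambda>n. real n * \<epsilon> n powr ((1 + 2 * real qb) * min (real sb) (s - 1) / (real qb - 1))) \<longlonglongrightarrow> 0"
      "filterlim (\<lambda>n. real n * \<epsilon> n powr (1 + 2 * real qb)) at_top sequentially"
    note hyps = orders(1,2) lim
    show "small_oP1 M (\<lambda>n \<omega>. rate_a q n powr (real q - real (2*l - 1))
      * (D_BR sb c lam (Upsilon (\<Gamma>h n \<omega>) (\<Phi>h n \<omega>) (\<theta>h n \<omega>)) x (\<epsilon> n) (2*l - 1) - D_coef \<theta>0 \<Phi>0 x q (2*l - 1)))"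
      if "l \<in> {1..(qb + 1) div 2}" for l
      by (rule null_in_prob_imp_small_oP1[OF finite_M error_null[OF hyps that]])
    show "conv_ucc_in_prob M (\<lambda>n \<omega> v. sqrt (real n * rate_a q n)
        * M_tilde qb (\<lambda>j. D_BR sb c lam (Upsilon (\<Gamma>h n \<omega>) (\<Phi>h n \<omega>) (\<theta>h n \<omega>)) x (\<epsilon> n) j) (v / rate_a q n))
      (M_limit \<theta>0 \<Phi>0 x q)"
      by (rule M_tilde_conv[OF hyps])
    \<comment> \<open>Half the leading coefficient serves all \<open>K\<close> at once.\<close>
    show "\<exists>c0>0. \<forall>K>0. liminf (\<lambda>n. ereal (measure (M n)
        {\<omega> \<in> space (M n). (INF v\<in>{v. \<bar>v\<bar> > 1 / K}.
          M_tilde qb (\<lambda>j. D_BR sb c lam (Upsilon (\<Gamma>h n \<omega>) (\<Phi>h n \<omega>) (\<theta>h n \<omega>)) x (\<epsilon> n) j) v) \<ge> c0 / K ^ (q + 1)})) = 1"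
      using M_tilde_liminf[OF hyps] Dc_q_pos
      by (intro exI[of _ "D_coef \<theta>0 \<Phi>0 x q q / 2"]) simp
  qed
qed

end
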